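(* Let $\varphi$ be a non-negative measurable function on $(0,1]$, let $0<r<\infty$, $1<\vec p,\vec q<\infty$ (with $\vec p=(p_1,\dots,p_m)$, $\vec q=(q_1,\dots,q_m)$), and suppose $\sum_{i=1}^m\frac{N_{k^{(i)}}}{p_i}\ge\frac{N_k}{r}$. Then the weighted Hardy--Littlewood operator $\mathcal{H}_\varphi$ is bounded on $\dot M^r_{\vec p,\vec q,k}(\mathbb{R}^n)$ if and only if $$\int_0^1 t^{-\frac{N_k}{r}}\varphi(t)\,\mathrm{d}t<\infty.$$ Moreover, $$\|\mathcal{H}_\varphi\|_{\dot M^r_{\vec p,\vec q,k}(\mathbb{R}^n)\to\dot M^r_{\vec p,\vec q,k}(\mathbb{R}^n)}=\int_0^1 t^{-\frac{N_k}{r}}\varphi(t)\,\mathrm{d}t.$$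
   Context: Setting. Let $n\ge 2$, $\mathbb{R}^n=\mathbb{R}^{n_1}\times\cdots\times\mathbb{R}^{n_m}$ with $\sum_{i=1}^m n_i=n$, $n_i\ge1$. Let $k=(k_1,\dots,k_n)$ with all $k_j\ge 0$, split into blocks $k=(k^{(1)},\dots,k^{(m)})$ with $k^{(i)}=(k^{(i)}_1,\dots,k^{(i)}_{n_i})$. Put $N_{k^{(i)}}=n_i+2\sum_{v=1}^{n_i}k^{(i)}_v$ and $N_k=n+2\sum_{j=1}^n k_j=\sum_{i=1}^m N_{k^{(i)}}$. The Dunkl measure is $\mathrm{d}\mu_k(x)=\prod_{j=1}^n|x_j|^{2k_j}\,\mathrm{d}x$; write $|E|_k=\mu_k(E)$. $B(0,R)$ is the open Euclidean ball in $\mathbb{R}^n$ of center $0$ and radius $R$. On each unit sphere $\mathbb{S}^{n_i-1}\subset\mathbb{R}^{n_i}$ let $\mathrm{d}\sigma_{k^{(i)}}(\omega)=\prod_{v=1}^{n_i}|\omega_v|^{2k^{(i)}_v}\,\mathrm{d}\sigma(\omega)$, $\mathrm{d}\sigma$ the surface measure (counting measure on $\{\pm1\}$ if $n_i=1$). Vector inequalities such as $1<\vec p<\infty$ are understood componentwise. Mixed-norm radial-angular Dunkl--Lebesgue space. For $1<\vec p,\vec q<\infty$ and measurable $f:\mathbb{R}^n\to\mathbb{C}$, writing $x_i=\rho_i\omega_i\in\mathbb{R}^{n_i}$ in polar coordinates, $\|f\|_{L^{\vec p}_{\mathrm{rad},k}L^{\vec q}_{\mathrm{ang},k}(\mathbb{R}^n)}$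 is obtained by taking successively, for $i=1,2,\dots,m$ (block $1$ innermost), first the $L^{q_i}(\mathbb{S}^{n_i-1},\mathrm{d}\sigma_{k^{(i)}})$ norm in $\omega_i$ and then the $L^{p_i}((0,\infty),\rho_i^{N_{k^{(i)}}-1}\mathrm{d}\rho_i)$ norm in $\rho_i$; i.e. $$\|f\|=\Biggl(\int_0^\infty\Biggl(\int_{\mathbb{S}^{n_m-1}}\cdots\Biggl(\int_0^\infty\Biggl(\int_{\mathbb{S}^{n_1-1}}|f(\rho_1\omega_1,\dots,\rho_m\omega_m)|^{q_1}\mathrm{d}\sigma_{k^{(1)}}(\omega_1)\Biggr)^{\frac{p_1}{q_1}}\rho_1^{N_{k^{(1)}}-1}\mathrm{d}\rho_1\Biggr)^{\frac{q_2}{p_1}}\cdots\mathrm{d}\sigma_{k^{(m)}}(\omega_m)\Biggr)^{\frac{p_m}{q_m}}\rho_m^{N_{k^{(m)}}-1}\mathrm{d}\rho_m\Biggr)^{\frac1{p_m}}.$$ Mixed-norm radial-angular Dunkl central Morrey space. For $0<r<\infty$ with $\sum_{i=1}^m\frac{N_{k^{(i)}}}{p_i}\ge\frac{N_k}{r}$, $\dot M^r_{\vec p,\vec q,k}(\mathbb{R}^n)$ is the set of measurable $f$ with $$\|f\|_{\dot M^r_{\vec p,\vec q,k}(\mathbb{R}^n)}=\sup_{R>0}|B(0,R)|_k^{\frac1r-\frac1{N_k}\sum_{i=1}^m\frac{N_{k^{(i)}}}{p_i}}\,\|f\chi_{B(0,R)}\|_{L^{\vec p}_{\mathrm{rad},k}L^{\vec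 q}_{\mathrm{ang},k}(\mathbb{R}^n)}<\infty.$$ Operator. $\mathcal{H}_\varphi f(x)=\int_0^1 f(tx)\varphi(t)\,\mathrm{d}t$, whenever the integral is well defined. Bounded on a space $X$ means: $\mathcal{H}_\varphi f$ is defined almost everywhere for every $f\in X$ and $\|\mathcal{H}_\varphi f\|_X\le C\|f\|_X$ with $C$ independent of $f$; $\|\mathcal{H}_\varphi\|_{X\to X}$ is the least such $C$. *)

theory Defs
  imports "HOL-Analysis.Analysis"
begin

text \<open>
  The factorisation of \<open>real ^ 'n\<close> into blocks is given by a map \<open>\<beta> :: 'n \<Rightarrow> nat\<close> with range
  \<open>{1..m}\<close>: coordinate \<open>j\<close> belongs to block \<open>\<beta> j\<close>, and the \<open>i\<close>-th factor has dimension
  \<open>card (block \<beta> i) \<ge> 1\<close>. A vector of the factor belonging to a set \<open>J\<close> of coordinates is an element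
  of the product space \<open>\<Pi>\<^sub>M j\<in>J. lborel\<close>, and its Euclidean norm is \<open>L2_set x J\<close>.
\<close>

definition block :: "('n \<Rightarrow> nat) \<Rightarrow> nat \<Rightarrow> 'n set" where
  "block \<beta> i = {j. \<beta> j = i}"

definition hom_dim :: "('n \<Rightarrow> real) \<Rightarrow> 'n set \<Rightarrow> real" where
  "hom_dim k J = real (card J) + 2 * (\<Sum>j\<in>J. k j)"

text \<open>
  In the weights, \<open>0 powr 0 = 0\<close> instead of \<open>1\<close>. This affects only points with a vanishing
  coordinate, which form a null set of \<open>real ^ 'n\<close> and of every sphere.
\<close>

definition dunkl_measure :: "('n::finite \<Rightarrow> real) \<Rightarrow> (real ^ 'n) measure" where
  "dunkl_measure k = density lborel (\<lambda>x. ennreal (\<Prod>j\<in>UNIV. \<bar>x $ j\<bar> powr (2 * k j)))"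

definition unit_sphere :: "'n set \<Rightarrow> ('n \<Rightarrow> real) set" where
  "unit_sphere J = {\<omega> \<in> J \<rightarrow>\<^sub>E UNIV. L2_set \<omega> J = 1}"

text \<open>
  Surface measure: \<open>\<sigma> A\<close> is the dimension times the Lebesgue measure of the cone
  \<open>{\<rho> \<omega> | \<rho> \<omega>. 0 < \<rho> \<and> \<rho> < 1 \<and> \<omega> \<in> A}\<close>. In dimension one this is the counting measure on the two
  points \<open>\<plusminus>1\<close>.
\<close>

definition surface_measure :: "'n set \<Rightarrow> ('n \<Rightarrow> real) measure" where
  "surface_measure J =
     scale_measure (of_nat (card J))
       (distr (restrict_space (\<Pi>\<^sub>M j\<in>J. lborel) {x. 0 < L2_set x J \<and> L2_set x J < 1})
              (restrict_space (\<Pi>\<^sub>M j\<in>J. lborel) (unit_sphere J))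
              (\<lambda>x. \<lambda>j\<in>J. x j / L2_set x J))"

lemma measurable_L2_set:
  assumes "finite J"
  shows "(\<lambda>x. L2_set x J) \<in> borel_measurable (\<Pi>\<^sub>M j\<in>J. lborel)"
  unfolding L2_set_def using assms by measurable

lemma L2_set_normalise:
  assumes "0 < L2_set x J"
  shows "L2_set (\<lambda>j\<in>J. x j / L2_set x J) J = 1"
proof -
  have "L2_set (\<lambda>j\<in>J. x j / L2_set x J) J = L2_set (\<lambda>j. inverse (L2_set x J) * x j) J"
    by (intro L2_set_cong) (auto simp: field_simps)
  also have "\<dots> = inverse (L2_set x J) * L2_set x J"
    using assms by (subst L2_set_right_distrib) auto
  finally show ?thesis using assms by simp
qed

lemma measurable_normalise:
  assumes "finite J"
  shows "(\<lambda>x. \<lambda>j\<in>J. x j / L2_set x J) \<in>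
    restrict_space (\<Pi>\<^sub>M j\<in>J. lborel) {x. 0 < L2_set x J \<and> L2_set x J < 1}
      \<rightarrow>\<^sub>M restrict_space (\<Pi>\<^sub>M j\<in>J. lborel) (unit_sphere J)"
proof (rule measurable_restrict_space2)
  show "(\<lambda>x. \<lambda>j\<in>J. x j / L2_set x J) \<in>
    space (restrict_space (\<Pi>\<^sub>M j\<in>J. lborel) {x. 0 < L2_set x J \<and> L2_set x J < 1}) \<rightarrow> unit_sphere J"
    by (auto simp: unit_sphere_def space_restrict_space L2_set_normalise)
  note [measurable] = measurable_L2_set[OF assms]
  show "(\<lambda>x. \<lambda>j\<in>J. x j / L2_set x J) \<in>
    restrict_space (\<Pi>\<^sub>M j\<in>J. lborel) {x. 0 < L2_set x J \<and> L2_set x J < 1} \<rightarrow>\<^sub>M (\<Pi>\<^sub>M j\<in>J. lborel)"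
    by (rule measurable_restrict_space1) measurable
qed

definition dunkl_sphere :: "('n \<Rightarrow> real) \<Rightarrow> 'n set \<Rightarrow> ('n \<Rightarrow> real) measure" where
  "dunkl_sphere k J =
     density (surface_measure J) (\<lambda>\<omega>. ennreal (\<Prod>j\<in>J. \<bar>\<omega> j\<bar> powr (2 * k j)))"

text \<open>Powers of extended non-negative numbers, used only for exponents \<open>s > 0\<close>.\<close>

definition enn_powr :: "ennreal \<Rightarrow> real \<Rightarrow> ennreal" where
  "enn_powr a s = (if a = \<infinity> then \<infinity> else ennreal (enn2real a powr s))"

definition ang_norm :: "('n \<Rightarrow> real) \<Rightarrow> 'n set \<Rightarrow> real \<Rightarrow> (('n \<Rightarrow> real) \<Rightarrow> ennreal) \<Rightarrow> ennreal" where
  "ang_norm k J q F = enn_powr (\<integral>\<^sup>+\<omega>. enn_powr (F \<omega>) q \<partial>dunkl_sphere k J) (1 / q)"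

definition rad_norm :: "('n \<Rightarrow> real) \<Rightarrow> 'n set \<Rightarrow> real \<Rightarrow> (real \<Rightarrow> ennreal) \<Rightarrow> ennreal" where
  "rad_norm k J p F =
     enn_powr (\<integral>\<^sup>+\<rho>\<in>{0<..}. (enn_powr (F \<rho>) p * ennreal (\<rho> powr (hom_dim k J - 1))) \<partial>lborel) (1 / p)"

definition set_block :: "'n::finite set \<Rightarrow> real \<Rightarrow> ('n \<Rightarrow> real) \<Rightarrow> real ^ 'n \<Rightarrow> real ^ 'n" where
  "set_block J \<rho> \<omega> x = (\<chi> j. if j \<in> J then \<rho> * \<omega> j else x $ j)"

text \<open>
  \<open>partial_norm \<beta> k p q f i x\<close> is the result of taking the norms of blocks \<open>1, \<dots>, i\<close>, in this order
  from the inside out; it depends only on the coordinates of \<open>x\<close> outside these blocks.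
\<close>

primrec partial_norm :: "('n::finite \<Rightarrow> nat) \<Rightarrow> ('n \<Rightarrow> real) \<Rightarrow> (nat \<Rightarrow> real) \<Rightarrow> (nat \<Rightarrow> real) \<Rightarrow>
    (real ^ 'n \<Rightarrow> complex) \<Rightarrow> nat \<Rightarrow> real ^ 'n \<Rightarrow> ennreal" where
  "partial_norm \<beta> k p q f 0 = (\<lambda>x. ennreal (cmod (f x)))"
| "partial_norm \<beta> k p q f (Suc i) = (\<lambda>x.
     rad_norm k (block \<beta> (Suc i)) (p (Suc i)) (\<lambda>\<rho>.
       ang_norm k (block \<beta> (Suc i)) (q (Suc i)) (\<lambda>\<omega>.
         partial_norm \<beta> k p q f i (set_block (block \<beta> (Suc i)) \<rho> \<omega> x))))"

text \<open>After all \<open>m\<close> blocks nothing depends on the point any more, so it is evaluated at \<open>0\<close>.\<close>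

definition mixed_norm :: "('n::finite \<Rightarrow> nat) \<Rightarrow> nat \<Rightarrow> ('n \<Rightarrow> real) \<Rightarrow> (nat \<Rightarrow> real) \<Rightarrow> (nat \<Rightarrow> real) \<Rightarrow>
    (real ^ 'n \<Rightarrow> complex) \<Rightarrow> ennreal" where
  "mixed_norm \<beta> m k p q f = partial_norm \<beta> k p q f m 0"

definition morrey_norm :: "('n::finite \<Rightarrow> nat) \<Rightarrow> nat \<Rightarrow> ('n \<Rightarrow> real) \<Rightarrow> real \<Rightarrow> (nat \<Rightarrow> real) \<Rightarrow>
    (nat \<Rightarrow> real) \<Rightarrow> (real ^ 'n \<Rightarrow> complex) \<Rightarrow> ennreal" where
  "morrey_norm \<beta> m k r p q f =
     (SUP R\<in>{0<..}.
        ennreal (measure (dunkl_measure k) (ball 0 R) powr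
          (1 / r - 1 / hom_dim k UNIV * (\<Sum>i = 1..m. hom_dim k (block \<beta> i) / p i)))
        * mixed_norm \<beta> m k p q (\<lambda>x. f x * indicator (ball 0 R) x))"

definition morrey_space :: "('n::finite \<Rightarrow> nat) \<Rightarrow> nat \<Rightarrow> ('n \<Rightarrow> real) \<Rightarrow> real \<Rightarrow> (nat \<Rightarrow> real) \<Rightarrow>
    (nat \<Rightarrow> real) \<Rightarrow> (real ^ 'n \<Rightarrow> complex) set" where
  "morrey_space \<beta> m k r p q =
     {f. f \<in> borel_measurable lebesgue \<and> morrey_norm \<beta> m k r p q f < \<infinity>}"

definition hardy_defined_at :: "(real \<Rightarrow> real) \<Rightarrow> (real ^ 'n::finite \<Rightarrow> complex) \<Rightarrow> real ^ 'n \<Rightarrow> bool" where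
  "hardy_defined_at \<phi> f x \<longleftrightarrow>
     integrable (lebesgue_on {0<..1}) (\<lambda>t. f (t *\<^sub>R x) * complex_of_real (\<phi> t))"

definition hardy :: "(real \<Rightarrow> real) \<Rightarrow> (real ^ 'n::finite \<Rightarrow> complex) \<Rightarrow> real ^ 'n \<Rightarrow> complex" where
  "hardy \<phi> f x = (LINT t|lebesgue_on {0<..1}. f (t *\<^sub>R x) * complex_of_real (\<phi> t))"

text \<open>
  Membership of \<open>hardy \<phi> f\<close> in the space is required explicitly, because \<open>morrey_norm\<close> is
  meaningful only for measurable functions.
\<close>

definition hardy_bound :: "('n::finite \<Rightarrow> nat) \<Rightarrow> nat \<Rightarrow> ('n \<Rightarrow> real) \<Rightarrow> real \<Rightarrow> (nat \<Rightarrow> real) \<Rightarrow>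
    (nat \<Rightarrow> real) \<Rightarrow> (real \<Rightarrow> real) \<Rightarrow> real \<Rightarrow> bool" where
  "hardy_bound \<beta> m k r p q \<phi> C \<longleftrightarrow> 0 \<le> C \<and>
     (\<forall>f \<in> morrey_space \<beta> m k r p q.
        (AE x in lebesgue. hardy_defined_at \<phi> f x) \<and>
        hardy \<phi> f \<in> morrey_space \<beta> m k r p q \<and>
        morrey_norm \<beta> m k r p q (hardy \<phi> f) \<le> ennreal C * morrey_norm \<beta> m k r p q f)"

definition hardy_bounded :: "('n::finite \<Rightarrow> nat) \<Rightarrow> nat \<Rightarrow> ('n \<Rightarrow> real) \<Rightarrow> real \<Rightarrow> (nat \<Rightarrow> real) \<Rightarrow>
    (nat \<Rightarrow> real) \<Rightarrow> (real \<Rightarrow> real) \<Rightarrow> bool" where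
  "hardy_bounded \<beta> m k r p q \<phi> \<longleftrightarrow> (\<exists>C. hardy_bound \<beta> m k r p q \<phi> C)"

definition hardy_opnorm :: "('n::finite \<Rightarrow> nat) \<Rightarrow> nat \<Rightarrow> ('n \<Rightarrow> real) \<Rightarrow> real \<Rightarrow> (nat \<Rightarrow> real) \<Rightarrow>
    (nat \<Rightarrow> real) \<Rightarrow> (real \<Rightarrow> real) \<Rightarrow> ennreal" where
  "hardy_opnorm \<beta> m k r p q \<phi> =
     (if hardy_bounded \<beta> m k r p q \<phi>
      then ennreal (LEAST C. hardy_bound \<beta> m k r p q \<phi> C) else \<infinity>)"

end

theory Submission
  imports Defs
begin

text \<open>
  The central Morrey norm scales exactly: \<open>\<parallel>f(t \<cdot>)\<parallel> = t powr (- (N / r)) * \<parallel>f\<parallel>\<close>. Boundedness with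
  constant \<open>\<integral> t powr (- (N / r)) * \<phi> t\<close> therefore follows from Minkowski's integral inequality, applied
  to each of the \<open>2 m\<close> norms making up the mixed norm. For sharpness let \<open>f\<close> be
  \<open>\<bar>x\<bar> powr (- (N / r + \<epsilon>))\<close> on \<open>\<bar>x\<bar> > 1\<close> and \<open>0\<close> elsewhere. Restricting the integral to \<open>t > \<delta>\<close>
  shows that the Hardy operator maps \<open>f\<close> to a function that is at least
  \<open>(\<integral>\<^bsub>t > \<delta>\<^esub> t powr (- (N / r)) * \<phi> t) * \<delta> powr (N / r + \<epsilon>) * f (\<delta> x)\<close>, whose norm is
  \<open>\<delta> powr \<epsilon>\<close> times the truncated integral times \<open>\<parallel>f\<parallel>\<close>; now let \<open>\<epsilon>\<close> and then \<open>\<delta>\<close> tend to \<open>0\<close>.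

  Functions are only Lebesgue measurable, so sections need not be measurable. Both a.e. invariance
  of the norm and the fact that a finite norm forces a.e. finiteness rest on null sets of \<open>real ^ 'n\<close>
  being exactly the sets almost all of whose polar sections in a block are null.
\<close>

subsection \<open>Powers of extended non-negative reals\<close>

text \<open>Let \<open>S\<close> be the sum of the quotients N_i / p_i. The function |x|^(-N/r) is a
  formal eigenfunction of the Hardy operator whose eigenvalue is the claimed norm, but it may lie
  outside the space: if \<open>S = N / r\<close>, the ball weight is constant, the space is a mixed
  Lebesgue space, and the norm diverges logarithmically at 0 and at infinity. Raising the exponent
  by \<open>\<epsilon>\<close> produces decay at infinity; the cut-off removes the singularity at 0,
  which has become worse. The price is homogeneity, since at \<open>x\<close> only t > 1/|x|
  contribute. With \<open>\<delta>\<close> fixed this range no longer depends on \<open>x\<close> as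
  long as |\<delta> x| > 1, and that region is the support of the dilated test function. The loss is
  therefore read off from the scaling law, and no norm of a test function is ever computed. The
  scaling law is exact because the mixed norm yields t^(-S), while the ball weight grows like R^(N/r
  - S), which cancels \<open>S\<close>. Minkowski's inequality is obtained without duality: each
  function is normalised by its own norm and Jensen's inequality is applied with these norms as
  weight.\<close>

lemma enn_powr_ennreal: "0 \<le> x \<Longrightarrow> enn_powr (ennreal x) s = ennreal (x powr s)"
  by (simp add: enn_powr_def)

lemma enn_powr_top [simp]: "enn_powr \<infinity> s = \<infinity>" "enn_powr top s = top"
  by (auto simp: enn_powr_def)

lemma enn_powr_0 [simp]: "enn_powr 0 s = 0"
  by (simp add: enn_powr_def)

lemma enn_powr_1 [simp]: "enn_powr 1 s = 1"
  by (simp add: enn_powr_def)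

lemma enn_powr_eq_0_iff [simp]: "enn_powr a s = 0 \<longleftrightarrow> a = 0"
  by (cases a) (auto simp: enn_powr_ennreal ennreal_eq_0_iff)

lemma enn_powr_eq_top_iff [simp]: "enn_powr a s = top \<longleftrightarrow> a = top"
  by (cases a) (auto simp: enn_powr_ennreal)

lemma enn_powr_less_top_iff [simp]: "enn_powr a s < top \<longleftrightarrow> a < top"
  by (metis enn_powr_eq_top_iff less_top)

lemma enn_powr_mono: "a \<le> b \<Longrightarrow> 0 < s \<Longrightarrow> enn_powr a s \<le> enn_powr b s"
  by (cases a; cases b) (auto simp: enn_powr_ennreal top_unique intro!: ennreal_leI powr_mono2)

text \<open>Valid for every real \<open>s\<close>, because \<open>enn_powr\<close> fixes both 0 and
  \<open>top\<close>, so the convention \<open>0 * top = 0\<close> is respected.\<close>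

lemma enn_powr_mult: "enn_powr (a * b) s = enn_powr a s * enn_powr b s"
proof (cases "a = top \<or> b = top")
  case True
  then show ?thesis by (auto simp: ennreal_mult_top ennreal_top_mult)
next
  case False
  then show ?thesis
    by (cases a; cases b)
       (auto simp: enn_powr_ennreal ennreal_mult[symmetric] powr_mult)
qed

lemma enn_powr_powr: "enn_powr (enn_powr a s) u = enn_powr a (s * u)"
  by (cases a) (auto simp: enn_powr_ennreal powr_powr)

lemma enn_powr_one [simp]: "enn_powr a 1 = a"
  by (cases a) (auto simp: enn_powr_ennreal)

lemma enn_powr_inverse_cancel:
  "s \<noteq> 0 \<Longrightarrow> enn_powr (enn_powr a s) (1 / s) = a"
  "s \<noteq> 0 \<Longrightarrow> enn_powr (enn_powr a (1 / s)) s = a"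
  by (simp_all add: enn_powr_powr)

lemma measurable_enn_powr [measurable]: "(\<lambda>a. enn_powr a s) \<in> borel_measurable borel"
  unfolding enn_powr_def by measurable

subsection \<open>Minkowski's integral inequality\<close>

text \<open>Common form of the angular and the radial norm, so that one Minkowski inequality serves
  both.\<close>

definition Lp_norm :: "'a measure \<Rightarrow> real \<Rightarrow> ('a \<Rightarrow> ennreal) \<Rightarrow> ennreal" where
  "Lp_norm \<mu> s F = enn_powr (\<integral>\<^sup>+x. enn_powr (F x) s \<partial>\<mu>) (1 / s)"

text \<open>Convexity: the tangent of \<open>h powr s\<close> at \<open>a\<close> lies below the
  graph. It is arranged without subtraction of functions so that it carries over to
  \<open>ennreal\<close>. Young's inequality with exponents \<open>s\<close> and
  \<open>s / (s - 1)\<close> gives it directly.\<close>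

lemma young_tangent:
  fixes h a s :: real
  assumes "1 < s" "0 \<le> h" "0 \<le> a"
  shows "s * a powr (s - 1) * h \<le> h powr s + (s - 1) * a powr s"
proof -
  have "h * a powr (s - 1) \<le> h powr s / s + (a powr (s - 1)) powr (s / (s - 1)) / (s / (s - 1))"
    using assms by (intro Youngs_inequality) (auto simp: field_simps)
  also have "(a powr (s - 1)) powr (s / (s - 1)) = a powr s"
    using assms by (simp add: powr_powr)
  finally have "s * (h * a powr (s - 1)) \<le> s * (h powr s / s + a powr s / (s / (s - 1)))"
    using assms by (intro mult_left_mono) auto
  also have "\<dots> = h powr s + (s - 1) * a powr s"
    using assms by (simp add: distrib_left)
  finally show ?thesis by (simp add: ac_simps)
qed

text \<open>Integrates the tangent inequality at \<open>a = (\<integral> h w) / W\<close>.\<close>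

lemma nn_integral_jensen_powr:
  assumes [measurable]: "h \<in> borel_measurable \<nu>" "w \<in> borel_measurable \<nu>"
    and s: "1 < s" and W: "(\<integral>\<^sup>+t. w t \<partial>\<nu>) = ennreal W" "0 < W"
  shows "enn_powr (\<integral>\<^sup>+t. h t * w t \<partial>\<nu>) s \<le> ennreal (W powr (s - 1)) * (\<integral>\<^sup>+t. enn_powr (h t) s * w t \<partial>\<nu>)"
proof (cases "\<integral>\<^sup>+t. h t * w t \<partial>\<nu>")
  case (real b)
  define a where "a = b / W"
  have a: "0 \<le> a" using real W by (simp add: a_def)
  have pt: "ennreal (s * a powr (s - 1)) * h t \<le> enn_powr (h t) s + ennreal ((s - 1) * a powr s)" for t
  proof (cases "h t")
    case (real x)
    then show ?thesis
      using young_tangent[OF s _ a, of x] s a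
      by (simp add: enn_powr_ennreal ennreal_mult[symmetric] ennreal_plus[symmetric] del: ennreal_plus)
  qed auto
  have "ennreal (s * a powr (s - 1)) * ennreal b = (\<integral>\<^sup>+t. ennreal (s * a powr (s - 1)) * (h t * w t) \<partial>\<nu>)"
    by (subst nn_integral_cmult) (auto simp: real)
  also have "\<dots> \<le> (\<integral>\<^sup>+t. enn_powr (h t) s * w t + ennreal ((s - 1) * a powr s) * w t \<partial>\<nu>)"
  proof (intro nn_integral_mono)
    fix t
    show "ennreal (s * a powr (s - 1)) * (h t * w t) \<le> enn_powr (h t) s * w t + ennreal ((s - 1) * a powr s) * w t"
      using mult_right_mono[OF pt[of t], of "w t"] by (simp add: distrib_right mult.assoc)
  qed
  also have "\<dots> = (\<integral>\<^sup>+t. enn_powr (h t) s * w t \<partial>\<nu>) + ennreal ((s - 1) * a powr s) * ennreal W"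
    by (subst nn_integral_add) (auto simp: nn_integral_cmult W)
  finally have *: "ennreal (s * a powr (s - 1)) * ennreal b \<le>
    (\<integral>\<^sup>+t. enn_powr (h t) s * w t \<partial>\<nu>) + ennreal ((s - 1) * a powr s) * ennreal W" .
  show ?thesis
  proof (cases "\<integral>\<^sup>+t. enn_powr (h t) s * w t \<partial>\<nu>")
    case (real c)
    have "s * a powr (s - 1) * b \<le> c + (s - 1) * a powr s * W"
      using * s a W \<open>0 \<le> b\<close> \<open>0 \<le> c\<close>
      unfolding real by (simp add: ennreal_mult[symmetric] ennreal_plus[symmetric] del: ennreal_plus)
    moreover have "a powr (s - 1) * b = a powr s * W"
    proof (cases "a = 0")
      case False
      then have "a powr s = a powr (s - 1) * a" using a by (simp add: powr_diff)
      then show ?thesis using W by (simp add: a_def)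
    qed (use s in auto)
    then have "s * a powr (s - 1) * b = s * (a powr s * W)"
      by (simp only: mult.assoc)
    ultimately have "s * (a powr s * W) \<le> c + (s * (a powr s * W) - a powr s * W)"
      by (simp only: left_diff_distrib mult.assoc mult_1_left)
    then have "a powr s * W \<le> c" by linarith
    then have "W powr (s - 1) * (a powr s * W) \<le> W powr (s - 1) * c"
      by (intro mult_left_mono) auto
    also have "W powr (s - 1) * (a powr s * W) = b powr s"
      using W \<open>0 \<le> b\<close> by (simp add: a_def powr_divide powr_diff)
    finally show ?thesis
      using real \<open>(\<integral>\<^sup>+t. h t * w t \<partial>\<nu>) = ennreal b\<close> \<open>0 \<le> b\<close> \<open>0 \<le> c\<close>
      by (simp add: enn_powr_ennreal ennreal_mult[symmetric])
  qed (use W in \<open>auto simp: ennreal_mult_top\<close>)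
next
  case top
  \<comment> \<open>An infinite left side forces an infinite right side, since
    \<open>h t \<le> 1 + enn_powr (h t) s\<close> and the weight has finite total mass.\<close>
  have "h t * w t \<le> w t + enn_powr (h t) s * w t" for t
  proof -
    have "h t \<le> 1 + enn_powr (h t) s"
    proof (cases "h t")
      case (real x)
      show ?thesis
      proof (cases "x \<le> 1")
        case True
        then show ?thesis using real by (metis add_increasing2 ennreal_le_1 zero_le)
      next
        case False
        then have "x powr 1 \<le> x powr s" using s by (intro powr_mono) auto
        then show ?thesis using real False
          by (auto simp: enn_powr_ennreal intro!: add_increasing ennreal_leI)
      qed
    qed auto
    then show ?thesis using mult_right_mono[of "h t" "1 + enn_powr (h t) s" "w t"]
      by (simp add: distrib_right)
  qed
  then have "top \<le> (\<integral>\<^sup>+t. w t + enn_powr (h t) s * w t \<partial>\<nu>)"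
    unfolding top[symmetric] by (intro nn_integral_mono) auto
  also have "\<dots> = ennreal W + (\<integral>\<^sup>+t. enn_powr (h t) s * w t \<partial>\<nu>)"
    by (subst nn_integral_add) (auto simp: W)
  finally have "(\<integral>\<^sup>+t. enn_powr (h t) s * w t \<partial>\<nu>) = top"
    by (simp add: top_unique)
  then show ?thesis using W by (simp add: ennreal_mult_top)
qed

text \<open>The product is 1 for \<open>0 < x < top\<close> and 0 at both ends, so dividing a
  function by its norm gives norm at most 1 even in the degenerate cases.\<close>

lemma inverse_mult_le_1: "inverse x * (x::ennreal) \<le> 1"
  by (cases x; cases "x = 0")
     (auto simp: inverse_ennreal ennreal_mult[symmetric] ennreal_top_mult)

text \<open>Write \<open>G t x\<close> as its quotient by \<open>w t\<close>, the norm of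
  \<open>G t\<close>, times \<open>w t\<close>. Jensen in \<open>t\<close> with weight
  \<open>w\<close> of mass \<open>W\<close>, followed by Tonelli, bounds the \<open>s\<close>-th
  power of the left side by \<open>W powr (s - 1)\<close> times the integral of \<open>w\<close>,
  which is \<open>W powr s\<close>.\<close>

lemma Lp_norm_nn_integral_le:
  assumes "sigma_finite_measure \<nu>" "sigma_finite_measure \<mu>"
    and G[measurable]: "case_prod G \<in> borel_measurable (\<nu> \<Otimes>\<^sub>M \<mu>)" and s: "1 < s"
  shows "Lp_norm \<mu> s (\<lambda>x. \<integral>\<^sup>+t. G t x \<partial>\<nu>) \<le> (\<integral>\<^sup>+t. Lp_norm \<mu> s (G t) \<partial>\<nu>)"
proof -
  interpret \<nu>: sigma_finite_measure \<nu> by fact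
  interpret \<mu>: sigma_finite_measure \<mu> by fact
  interpret pair_sigma_finite \<nu> \<mu> ..
  define w where "w t = Lp_norm \<mu> s (G t)" for t
  have w[measurable]: "w \<in> borel_measurable \<nu>"
    unfolding w_def Lp_norm_def by measurable
  have wp: "(\<integral>\<^sup>+x. enn_powr (G t x) s \<partial>\<mu>) = enn_powr (w t) s" for t
    using s by (simp add: w_def Lp_norm_def enn_powr_inverse_cancel)
  show ?thesis
  proof (cases "(\<integral>\<^sup>+t. w t \<partial>\<nu>) = top")
    case True
    then show ?thesis by (simp add: w_def)
  next
    case False
    then obtain W where W: "(\<integral>\<^sup>+t. w t \<partial>\<nu>) = ennreal W" "0 \<le> W"
      by (metis ennreal_cases)
    have fin: "AE t in \<nu>. w t \<noteq> top"
      using nn_integral_PInf_AE[OF w] False by simp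
    \<comment> \<open>Dividing by \<open>w t\<close> would lose \<open>G t x\<close> where
      \<open>w t = 0\<close>. There \<open>G t\<close> vanishes almost everywhere, and Tonelli turns
      this into a statement for almost every fixed \<open>x\<close>.\<close>
    have "AE t in \<nu>. AE x in \<mu>. w t = 0 \<longrightarrow> G t x = 0"
    proof (rule AE_I2)
      fix t assume [measurable]: "t \<in> space \<nu>"
      show "AE x in \<mu>. w t = 0 \<longrightarrow> G t x = 0"
      proof (cases "w t = 0")
        case True
        then have "(\<integral>\<^sup>+x. enn_powr (G t x) s \<partial>\<mu>) = 0" using wp by simp
        then show ?thesis by (subst (asm) nn_integral_0_iff_AE) auto
      qed auto
    qed
    then have zero: "AE x in \<mu>. AE t in \<nu>. w t = 0 \<longrightarrow> G t x = 0"
      by (subst (asm) AE_commute) auto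
    have fact: "AE x in \<mu>. (\<integral>\<^sup>+t. G t x \<partial>\<nu>) = (\<integral>\<^sup>+t. (G t x * inverse (w t)) * w t \<partial>\<nu>)"
      using zero
    proof eventually_elim
      case (elim x)
      show ?case
      proof (rule nn_integral_cong_AE)
        show "AE t in \<nu>. G t x = G t x * inverse (w t) * w t"
          using elim fin
        proof eventually_elim
          fix t assume *: "w t = 0 \<longrightarrow> G t x = 0" "w t \<noteq> top"
          show "G t x = G t x * inverse (w t) * w t"
          proof (cases "w t = 0")
            case False
            then have "inverse (w t) * w t = 1"
              using * by (cases "w t") (auto simp: inverse_ennreal ennreal_mult[symmetric])
            then show ?thesis by (simp add: mult.assoc)
          qed (use * in auto)
        qed
      qed
    qed
    show ?thesis
    proof (cases "W = 0")
      case True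
      \<comment> \<open>Jensen requires positive mass. With mass 0 the factorised integrand is
        already zero for almost every \<open>t\<close>.\<close>
      then have "AE t in \<nu>. w t = 0" using W by (simp add: nn_integral_0_iff_AE)
      then have "(\<integral>\<^sup>+t. (G t x * inverse (w t)) * w t \<partial>\<nu>) = 0" for x
        by (subst nn_integral_cong_AE[where v="\<lambda>_. 0"]) auto
      then have "(\<integral>\<^sup>+x. enn_powr (\<integral>\<^sup>+t. G t x \<partial>\<nu>) s \<partial>\<mu>) = (\<integral>\<^sup>+x. 0 \<partial>\<mu>)"
        using fact by (intro nn_integral_cong_AE) auto
      then show ?thesis by (simp add: Lp_norm_def)
    next
      case False
      then have W': "0 < W" using W by simp
      have "(\<integral>\<^sup>+x. enn_powr (\<integral>\<^sup>+t. G t x \<partial>\<nu>) s \<partial>\<mu>) \<le>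
          (\<integral>\<^sup>+x. ennreal (W powr (s - 1)) * (\<integral>\<^sup>+t. enn_powr (G t x * inverse (w t)) s * w t \<partial>\<nu>) \<partial>\<mu>)"
      proof (rule nn_integral_mono_AE)
        show "AE x in \<mu>. enn_powr (\<integral>\<^sup>+t. G t x \<partial>\<nu>) s \<le>
            ennreal (W powr (s - 1)) * (\<integral>\<^sup>+t. enn_powr (G t x * inverse (w t)) s * w t \<partial>\<nu>)"
          using fact AE_space
        proof eventually_elim
          fix x assume x: "(\<integral>\<^sup>+t. G t x \<partial>\<nu>) = (\<integral>\<^sup>+t. (G t x * inverse (w t)) * w t \<partial>\<nu>)"
            and [measurable]: "x \<in> space \<mu>"
          show "enn_powr (\<integral>\<^sup>+t. G t x \<partial>\<nu>) s \<le>
            ennreal (W powr (s - 1)) * (\<integral>\<^sup>+t. enn_powr (G t x * inverse (w t)) s * w t \<partial>\<nu>)"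
            unfolding x using W' W s by (intro nn_integral_jensen_powr) auto
        qed
      qed
      also have "\<dots> = ennreal (W powr (s - 1)) * (\<integral>\<^sup>+x. (\<integral>\<^sup>+t. enn_powr (G t x * inverse (w t)) s * w t \<partial>\<nu>) \<partial>\<mu>)"
        by (subst nn_integral_cmult) auto
      also have "(\<integral>\<^sup>+x. (\<integral>\<^sup>+t. enn_powr (G t x * inverse (w t)) s * w t \<partial>\<nu>) \<partial>\<mu>) =
          (\<integral>\<^sup>+t. (\<integral>\<^sup>+x. enn_powr (G t x * inverse (w t)) s * w t \<partial>\<mu>) \<partial>\<nu>)"
        by (rule Fubini') measurable
      also have "\<dots> \<le> (\<integral>\<^sup>+t. w t \<partial>\<nu>)"
      proof (rule nn_integral_mono)
        fix t assume [measurable]: "t \<in> space \<nu>"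
        have "(\<integral>\<^sup>+x. enn_powr (G t x * inverse (w t)) s * w t \<partial>\<mu>) =
            (\<integral>\<^sup>+x. enn_powr (G t x) s * (enn_powr (inverse (w t)) s * w t) \<partial>\<mu>)"
          by (simp add: enn_powr_mult mult.assoc)
        also have "\<dots> = enn_powr (inverse (w t) * w t) s * w t"
          by (subst nn_integral_multc) (auto simp: wp enn_powr_mult ac_simps)
        also have "\<dots> \<le> 1 * w t"
          using enn_powr_mono[OF inverse_mult_le_1[of "w t"], of s] s
          by (intro mult_right_mono) auto
        finally show "(\<integral>\<^sup>+x. enn_powr (G t x * inverse (w t)) s * w t \<partial>\<mu>) \<le> w t" by simp
      qed
      also have "ennreal (W powr (s - 1)) * (\<integral>\<^sup>+t. w t \<partial>\<nu>) = enn_powr (ennreal W) s"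
        using W W' by (simp add: enn_powr_ennreal ennreal_mult[symmetric] powr_diff)
      finally have "(\<integral>\<^sup>+x. enn_powr (\<integral>\<^sup>+t. G t x \<partial>\<nu>) s \<partial>\<mu>) \<le> enn_powr (ennreal W) s"
        by (simp add: mult_left_mono)
      then have "Lp_norm \<mu> s (\<lambda>x. \<integral>\<^sup>+t. G t x \<partial>\<nu>) \<le> enn_powr (enn_powr (ennreal W) s) (1 / s)"
        unfolding Lp_norm_def using s by (intro enn_powr_mono) auto
      also have "\<dots> = ennreal W" using s by (simp add: enn_powr_inverse_cancel)
      finally show ?thesis using W by (simp add: w_def)
    qed
  qed
qed

subsection \<open>Null sets in polar coordinates\<close>

lemma AE_scale_measure:
  assumes "c \<noteq> 0"
  shows "(AE x in scale_measure c M. P x) \<longleftrightarrow> (AE x in M. P x)"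
  using assms by (simp add: eventually_ae_filter null_sets_def space_scale_measure)

lemma product_sigma_finite_lborel: "product_sigma_finite (\<lambda>_. lborel :: real measure)"
  by standard

lemma sigma_finite_PiM_lborel:
  assumes "finite J"
  shows "sigma_finite_measure (\<Pi>\<^sub>M j\<in>J. lborel :: real measure)"
proof -
  interpret product_sigma_finite "\<lambda>_. lborel :: real measure"
    by (rule product_sigma_finite_lborel)
  show ?thesis using assms by (rule sigma_finite)
qed

lemma AE_lborel_mult_iff:
  fixes c :: real
  assumes [measurable]: "Measurable.pred borel P" and c: "c \<noteq> 0"
  shows "(AE x in lborel. P (c * x)) \<longleftrightarrow> (AE x in lborel. P x)"
proof -
  have "(AE x in lborel. P (c * x)) \<longleftrightarrow> (AE x in distr lborel borel ((*) c). P x)"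
    by (subst AE_distr_iff) auto
  then show ?thesis
    using c unfolding lborel_distr_mult[OF c] by (subst (asm) AE_density) auto
qed

text \<open>On boxes every coordinate contributes one factor \<open>\<bar>c\<bar>\<close>, and boxes
  determine the product measure.\<close>

lemma PiM_lborel_scale:
  fixes c :: real
  assumes J: "finite J" and c: "c \<noteq> 0"
  shows "scale_measure (ennreal \<bar>c\<bar> ^ card J)
      (distr (\<Pi>\<^sub>M j\<in>J. lborel) (\<Pi>\<^sub>M j\<in>J. lborel) (\<lambda>x. \<lambda>j\<in>J. c * x j)) = (\<Pi>\<^sub>M j\<in>J. lborel)"
proof -
  interpret product_sigma_finite "\<lambda>_. lborel :: real measure"
    by (rule product_sigma_finite_lborel)
  interpret finite_product_sigma_finite "\<lambda>_. lborel :: real measure" J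
    by standard (rule J)
  show ?thesis
  proof (rule PiM_eqI)
    fix A :: "'a \<Rightarrow> real set" assume "\<And>i. i \<in> J \<Longrightarrow> A i \<in> sets lborel"
    then have A[measurable]: "\<And>i. i \<in> J \<Longrightarrow> A i \<in> sets borel" by simp
    have B: "(\<lambda>x. c * x) -` A i \<in> sets borel" if "i \<in> J" for i
    proof -
      have "(\<lambda>x. c * x) -` A i \<inter> space borel \<in> sets borel"
        using that by (intro measurable_sets[OF _ A]) auto
      then show ?thesis by simp
    qed
    have em: "ennreal \<bar>c\<bar> * emeasure lborel ((\<lambda>x. c * x) -` A i) = emeasure lborel (A i)" if "i \<in> J" for i
    proof -
      have "emeasure lborel ((\<lambda>x. c * x) -` A i) = emeasure (distr lborel borel ((*) c)) (A i)"
        using A[OF that] by (subst emeasure_distr) auto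
      also have "\<dots> = ennreal (inverse \<bar>c\<bar>) * emeasure lborel (A i)"
        using A[OF that] c by (simp add: lborel_distr_mult emeasure_density nn_integral_cmult_indicator)
      finally show ?thesis
        using c by (simp add: mult.assoc[symmetric] ennreal_mult[symmetric])
    qed
    have "emeasure (distr (\<Pi>\<^sub>M j\<in>J. lborel) (\<Pi>\<^sub>M j\<in>J. lborel) (\<lambda>x. \<lambda>j\<in>J. c * x j)) (Pi\<^sub>E J A) =
        emeasure (\<Pi>\<^sub>M j\<in>J. lborel) ((\<lambda>x. \<lambda>j\<in>J. c * x j) -` (Pi\<^sub>E J A) \<inter> space (\<Pi>\<^sub>M j\<in>J. lborel :: real measure))"
      using J A by (intro emeasure_distr) (auto intro!: sets_PiM_I_finite)
    also have "(\<lambda>x. \<lambda>j\<in>J. c * x j) -` (Pi\<^sub>E J A) \<inter> space (\<Pi>\<^sub>M j\<in>J. lborel :: real measure)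
        = Pi\<^sub>E J (\<lambda>i. (\<lambda>x. c * x) -` A i)"
      by (auto simp: space_PiM PiE_iff)
    also have "emeasure (\<Pi>\<^sub>M j\<in>J. lborel) \<dots> = (\<Prod>i\<in>J. emeasure lborel ((\<lambda>x. c * x) -` A i))"
      using B by (intro measure_times) auto
    finally have D: "emeasure (distr (\<Pi>\<^sub>M j\<in>J. lborel) (\<Pi>\<^sub>M j\<in>J. lborel) (\<lambda>x. \<lambda>j\<in>J. c * x j)) (Pi\<^sub>E J A) =
        (\<Prod>i\<in>J. emeasure lborel ((\<lambda>x. c * x) -` A i))" .
    show "emeasure (scale_measure (ennreal \<bar>c\<bar> ^ card J)
      (distr (\<Pi>\<^sub>M j\<in>J. lborel) (\<Pi>\<^sub>M j\<in>J. lborel) (\<lambda>x. \<lambda>j\<in>J. c * x j))) (Pi\<^sub>E J A)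
       = (\<Prod>i\<in>J. emeasure lborel (A i))"
      unfolding emeasure_scale_measure D by (simp add: em[symmetric] prod.distrib)
  qed (use J in simp_all)
qed

lemma AE_PiM_lborel_scale_iff:
  fixes c :: real
  assumes J: "finite J" and c: "c \<noteq> 0" and [measurable]: "Measurable.pred (\<Pi>\<^sub>M j\<in>J. lborel) P"
  shows "(AE x in \<Pi>\<^sub>M j\<in>J. lborel. P (\<lambda>j\<in>J. c * x j)) \<longleftrightarrow> (AE x in \<Pi>\<^sub>M j\<in>J. lborel. P x)"
proof -
  have "(AE x in \<Pi>\<^sub>M j\<in>J. lborel. P (\<lambda>j\<in>J. c * x j)) \<longleftrightarrow>
      (AE x in distr (\<Pi>\<^sub>M j\<in>J. lborel) (\<Pi>\<^sub>M j\<in>J. lborel) (\<lambda>x. \<lambda>j\<in>J. c * x j). P x)"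
    by (subst AE_distr_iff) auto
  also have "\<dots> \<longleftrightarrow> (AE x in scale_measure (ennreal \<bar>c\<bar> ^ card J)
      (distr (\<Pi>\<^sub>M j\<in>J. lborel) (\<Pi>\<^sub>M j\<in>J. lborel) (\<lambda>x. \<lambda>j\<in>J. c * x j)). P x)"
    using c by (subst AE_scale_measure) auto
  finally show ?thesis
    unfolding PiM_lborel_scale[OF J c] .
qed

text \<open>The hyperplane is a box with one singleton side; its factor 0 prevails over the infinite
  sides.\<close>

lemma AE_PiM_lborel_component_neq:
  assumes J: "finite J" "j \<in> J"
  shows "AE x in \<Pi>\<^sub>M j\<in>J. lborel. x j \<noteq> (a :: real)"
proof -
  interpret product_sigma_finite "\<lambda>_. lborel :: real measure"
    by (rule product_sigma_finite_lborel)
  interpret finite_product_sigma_finite "\<lambda>_. lborel :: real measure" J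
    by standard (rule J)
  let ?A = "Pi\<^sub>E J (\<lambda>i. if i = j then {a} else UNIV)"
  have "emeasure (\<Pi>\<^sub>M j\<in>J. lborel) ?A = (\<Prod>i\<in>J. emeasure lborel (if i = j then {a} else UNIV :: real set))"
    by (intro measure_times) auto
  also have "\<dots> = 0"
    using J by (intro prod_zero) auto
  finally have "?A \<in> null_sets (\<Pi>\<^sub>M j\<in>J. lborel)"
    using J by (intro null_setsI) (auto intro!: sets_PiM_I_finite)
  then show ?thesis
    by (rule AE_I') (use J in \<open>auto simp: space_PiM PiE_iff extensional_def\<close>)
qed

lemma AE_surface_measure_iff:
  assumes J: "finite J" "J \<noteq> {}" and [measurable]: "Measurable.pred (\<Pi>\<^sub>M j\<in>J. lborel) P"
  shows "(AE \<omega> in surface_measure J. P \<omega>) \<longleftrightarrow>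
    (AE x in \<Pi>\<^sub>M j\<in>J. lborel. 0 < L2_set x J \<and> L2_set x J < 1 \<longrightarrow> P (\<lambda>j\<in>J. x j / L2_set x J))"
proof -
  note [measurable] = measurable_normalise[OF J(1)] measurable_L2_set[OF J(1)]
  let ?R = "restrict_space (\<Pi>\<^sub>M j\<in>J. lborel) {x. 0 < L2_set x J \<and> L2_set x J < 1}"
  have "Measurable.pred (restrict_space (\<Pi>\<^sub>M j\<in>J. lborel) (unit_sphere J)) P"
    by (rule measurable_restrict_space1) fact
  then have P: "{x \<in> space (restrict_space (\<Pi>\<^sub>M j\<in>J. lborel) (unit_sphere J)). P x}
      \<in> sets (restrict_space (\<Pi>\<^sub>M j\<in>J. lborel) (unit_sphere J))"
    by (simp only: pred_def)
  have c: "of_nat (card J) \<noteq> (0 :: ennreal)" using J by simp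
  have "(AE \<omega> in surface_measure J. P \<omega>) \<longleftrightarrow> (AE x in ?R. P (\<lambda>j\<in>J. x j / L2_set x J))"
    unfolding surface_measure_def AE_scale_measure[OF c]
    by (rule AE_distr_iff[OF measurable_normalise[OF J(1)] P])
  also have "\<dots> \<longleftrightarrow>
    (AE x in \<Pi>\<^sub>M j\<in>J. lborel. 0 < L2_set x J \<and> L2_set x J < 1 \<longrightarrow> P (\<lambda>j\<in>J. x j / L2_set x J))"
    by (subst AE_restrict_space_iff) auto
  finally show ?thesis .
qed

lemma L2_set_scale:
  "L2_set (\<lambda>j\<in>J. c * x j) J = \<bar>c\<bar> * L2_set x J"
proof -
  have "L2_set (\<lambda>j\<in>J. c * x j) J = L2_set (\<lambda>j. \<bar>c\<bar> * x j) J"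
    by (simp add: L2_set_def power_mult_distrib)
  then show ?thesis by (simp add: L2_set_right_distrib)
qed

text \<open>Substituting \<open>\<rho> = s \<bar>x\<bar>\<close> in the cone definition of the surface measure turns \<open>\<rho> \<omega>\<close> into \<open>s x\<close>.\<close>

lemma AE_polar_iff:
  assumes J: "finite J" "J \<noteq> {}" and [measurable]: "Measurable.pred (\<Pi>\<^sub>M j\<in>J. lborel) P"
  shows "(AE \<rho> in lborel. 0 < \<rho> \<longrightarrow> (AE \<omega> in surface_measure J. P (\<lambda>j\<in>J. \<rho> * \<omega> j))) \<longleftrightarrow>
    (AE x in \<Pi>\<^sub>M j\<in>J. lborel. P x)"
proof -
  note [measurable] = measurable_L2_set[OF J(1)]
  interpret PJ: sigma_finite_measure "\<Pi>\<^sub>M j\<in>J. lborel :: real measure"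
    using J by (intro sigma_finite_PiM_lborel)
  interpret pair_sigma_finite lborel "\<Pi>\<^sub>M j\<in>J. lborel :: real measure" ..
  have "(AE \<rho> in lborel. 0 < \<rho> \<longrightarrow> (AE \<omega> in surface_measure J. P (\<lambda>j\<in>J. \<rho> * \<omega> j))) \<longleftrightarrow>
    (AE \<rho> in lborel. AE x in \<Pi>\<^sub>M j\<in>J. lborel. 0 < \<rho> \<and> 0 < L2_set x J \<and> L2_set x J < 1 \<longrightarrow>
      P (\<lambda>j\<in>J. \<rho> * (x j / L2_set x J)))"
  proof (rule AE_cong)
    fix \<rho> :: real
    have "(AE \<omega> in surface_measure J. P (\<lambda>j\<in>J. \<rho> * \<omega> j)) \<longleftrightarrow>
      (AE x in \<Pi>\<^sub>M j\<in>J. lborel. 0 < L2_set x J \<and> L2_set x J < 1 \<longrightarrow>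
        P (\<lambda>j\<in>J. \<rho> * (\<lambda>j\<in>J. x j / L2_set x J) j))"
      using J by (intro AE_surface_measure_iff) auto
    then show "(0 < \<rho> \<longrightarrow> (AE \<omega> in surface_measure J. P (\<lambda>j\<in>J. \<rho> * \<omega> j))) \<longleftrightarrow>
      (AE x in \<Pi>\<^sub>M j\<in>J. lborel. 0 < \<rho> \<and> 0 < L2_set x J \<and> L2_set x J < 1 \<longrightarrow>
        P (\<lambda>j\<in>J. \<rho> * (x j / L2_set x J)))"
      by (cases "0 < \<rho>") (simp_all cong: restrict_cong)
  qed
  also have "\<dots> \<longleftrightarrow>
    (AE x in \<Pi>\<^sub>M j\<in>J. lborel. AE \<rho> in lborel. 0 < \<rho> \<and> 0 < L2_set x J \<and> L2_set x J < 1 \<longrightarrow>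
      P (\<lambda>j\<in>J. \<rho> * (x j / L2_set x J)))"
    by (rule AE_commute) measurable
  also have "\<dots> \<longleftrightarrow>
    (AE x in \<Pi>\<^sub>M j\<in>J. lborel. AE s in lborel. 0 < s \<and> 0 < L2_set x J \<and> L2_set x J < 1 \<longrightarrow>
      P (\<lambda>j\<in>J. s * x j))"
  proof (rule AE_cong)
    fix x assume [measurable]: "x \<in> space (\<Pi>\<^sub>M j\<in>J. lborel :: real measure)"
    show "(AE \<rho> in lborel. 0 < \<rho> \<and> 0 < L2_set x J \<and> L2_set x J < 1 \<longrightarrow>
          P (\<lambda>j\<in>J. \<rho> * (x j / L2_set x J))) \<longleftrightarrow>
        (AE s in lborel. 0 < s \<and> 0 < L2_set x J \<and> L2_set x J < 1 \<longrightarrow> P (\<lambda>j\<in>J. s * x j))"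
    proof (cases "0 < L2_set x J")
      case True
      have "(AE \<rho> in lborel. 0 < \<rho> \<and> 0 < L2_set x J \<and> L2_set x J < 1 \<longrightarrow>
          P (\<lambda>j\<in>J. \<rho> * (x j / L2_set x J))) \<longleftrightarrow>
        (AE s in lborel. 0 < L2_set x J * s \<and> 0 < L2_set x J \<and> L2_set x J < 1 \<longrightarrow>
          P (\<lambda>j\<in>J. (L2_set x J * s) * (x j / L2_set x J)))"
        using True by (intro AE_lborel_mult_iff[symmetric]) auto
      also have "\<dots> \<longleftrightarrow>
          (AE s in lborel. 0 < s \<and> 0 < L2_set x J \<and> L2_set x J < 1 \<longrightarrow> P (\<lambda>j\<in>J. s * x j))"
        using True by - (rule AE_cong, simp add: zero_less_mult_iff)
      finally show ?thesis .
    qed simp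
  qed
  also have "\<dots> \<longleftrightarrow>
    (AE s in lborel. AE x in \<Pi>\<^sub>M j\<in>J. lborel. 0 < s \<and> 0 < L2_set x J \<and> L2_set x J < 1 \<longrightarrow>
      P (\<lambda>j\<in>J. s * x j))"
    by (rule AE_commute[symmetric]) measurable
  \<comment> \<open>For fixed \<open>s\<close> put \<open>y = s x\<close>: the punctured unit ball
    becomes the punctured ball of radius \<open>s\<close>.\<close>
  also have "\<dots> \<longleftrightarrow>
    (AE s in lborel. AE y in \<Pi>\<^sub>M j\<in>J. lborel. 0 < s \<and> 0 < L2_set y J \<and> L2_set y J < s \<longrightarrow> P y)"
  proof (rule AE_cong)
    fix s :: real
    show "(AE x in \<Pi>\<^sub>M j\<in>J. lborel. 0 < s \<and> 0 < L2_set x J \<and> L2_set x J < 1 \<longrightarrow> P (\<lambda>j\<in>J. s * x j)) \<longleftrightarrow>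
      (AE y in \<Pi>\<^sub>M j\<in>J. lborel. 0 < s \<and> 0 < L2_set y J \<and> L2_set y J < s \<longrightarrow> P y)"
    proof (cases "0 < s")
      case True
      have "(AE x in \<Pi>\<^sub>M j\<in>J. lborel. 0 < L2_set (\<lambda>j\<in>J. s * x j) J \<and> L2_set (\<lambda>j\<in>J. s * x j) J < s \<longrightarrow>
            P (\<lambda>j\<in>J. s * x j)) \<longleftrightarrow>
          (AE y in \<Pi>\<^sub>M j\<in>J. lborel. 0 < L2_set y J \<and> L2_set y J < s \<longrightarrow> P y)"
        using J True by (intro AE_PiM_lborel_scale_iff) auto
      then show ?thesis
        using True by (simp only: L2_set_scale) (simp add: zero_less_mult_iff)
    qed simp
  qed
  also have "\<dots> \<longleftrightarrow> (AE x in \<Pi>\<^sub>M j\<in>J. lborel. P x)"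
  proof
    assume *: "AE s in lborel. AE y in \<Pi>\<^sub>M j\<in>J. lborel. 0 < s \<and> 0 < L2_set y J \<and> L2_set y J < s \<longrightarrow> P y"
    have "AE y in \<Pi>\<^sub>M j\<in>J. lborel. 0 < L2_set y J \<and> L2_set y J < real n \<longrightarrow> P y" for n
    proof -
      \<comment> \<open>A conull set of radii contains arbitrarily large ones, and one good radius
        beyond \<open>n\<close> settles the punctured ball of radius \<open>n\<close>.\<close>
      have "\<exists>s>real n. AE y in \<Pi>\<^sub>M j\<in>J. lborel. 0 < s \<and> 0 < L2_set y J \<and> L2_set y J < s \<longrightarrow> P y"
      proof (rule ccontr)
        assume "\<not> ?thesis"
        with * have "AE s in lborel. s \<notin> {real n<..}"
          by (auto elim!: eventually_mono)
        then have "{real n<..} \<in> null_sets lborel"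
          by (subst AE_iff_null_sets) auto
        moreover have "{real n<..<real n + 1} \<subseteq> {real n<..}" by auto
        ultimately have "{real n<..<real n + 1} \<in> null_sets lborel"
          using null_sets_subset[of "{real n<..}" lborel "{real n<..<real n + 1}"] by simp
        then show False by (simp add: null_sets_def)
      qed
      then obtain s where "s > real n"
        "AE y in \<Pi>\<^sub>M j\<in>J. lborel. 0 < s \<and> 0 < L2_set y J \<and> L2_set y J < s \<longrightarrow> P y" by auto
      then show ?thesis by (auto elim!: eventually_mono)
    qed
    then have 1: "AE y in \<Pi>\<^sub>M j\<in>J. lborel. \<forall>n. 0 < L2_set y J \<and> L2_set y J < real n \<longrightarrow> P y"
      by (subst AE_all_countable) auto
    \<comment> \<open>The origin is missed by all punctured balls; it is avoided almost everywhere
      because a single coordinate already is nonzero.\<close>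
    obtain j where j: "j \<in> J" using J by auto
    from 1 AE_PiM_lborel_component_neq[OF J(1) j, of 0]
    show "AE x in \<Pi>\<^sub>M j\<in>J. lborel. P x"
    proof eventually_elim
      case (elim y)
      have "L2_set y J \<noteq> 0" using elim j J by (auto simp: L2_set_eq_0_iff)
      then have "0 < L2_set y J" using L2_set_nonneg[of y J] by linarith
      then show ?case using elim reals_Archimedean2 by blast
    qed
  qed (auto elim: eventually_mono)
  finally show ?thesis .
qed

lemma AE_surface_measure_component_neq_0:
  assumes J: "finite J" "j \<in> J"
  shows "AE \<omega> in surface_measure J. \<omega> j \<noteq> 0"
proof -
  have "AE x in \<Pi>\<^sub>M j\<in>J. lborel. 0 < L2_set x J \<and> L2_set x J < 1 \<longrightarrow> (\<lambda>j\<in>J. x j / L2_set x J) j \<noteq> 0"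
    using AE_PiM_lborel_component_neq[OF J, of 0] J by (auto elim!: eventually_mono)
  then show ?thesis
    using J by (subst AE_surface_measure_iff) auto
qed

lemma measurable_surface_measure:
  assumes "f \<in> (\<Pi>\<^sub>M j\<in>J. lborel) \<rightarrow>\<^sub>M N"
  shows "f \<in> surface_measure J \<rightarrow>\<^sub>M N"
proof -
  have "sets (surface_measure J) = sets (restrict_space (\<Pi>\<^sub>M j\<in>J. lborel) (unit_sphere J))"
    by (simp add: surface_measure_def)
  then show ?thesis
    using measurable_restrict_space1[OF assms] measurable_cong_sets by blast
qed

text \<open>With \<open>0 powr 0 = 0\<close> the weight vanishes exactly where some coordinate does,
  whatever the values of \<open>k\<close>, and this set is null for the surface measure.\<close>

lemma AE_dunkl_sphere_iff:
  assumes J: "finite J"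
  shows "(AE \<omega> in dunkl_sphere k J. P \<omega>) \<longleftrightarrow> (AE \<omega> in surface_measure J. P \<omega>)"
proof -
  have "AE \<omega> in surface_measure J. \<forall>j\<in>J. \<omega> j \<noteq> 0"
    using J AE_surface_measure_component_neq_0[OF J] by (subst AE_ball_countable) (auto intro: countable_finite)
  then have *: "AE \<omega> in surface_measure J. 0 < ennreal (\<Prod>j\<in>J. \<bar>\<omega> j\<bar> powr (2 * k j))"
    by (auto elim!: eventually_mono intro!: prod_pos)
  have "(\<lambda>\<omega>. ennreal (\<Prod>j\<in>J. \<bar>\<omega> j\<bar> powr (2 * k j))) \<in> borel_measurable (surface_measure J)"
    by (rule measurable_surface_measure) measurable
  then have "(AE \<omega> in dunkl_sphere k J. P \<omega>) \<longleftrightarrow>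
      (AE \<omega> in surface_measure J. 0 < ennreal (\<Prod>j\<in>J. \<bar>\<omega> j\<bar> powr (2 * k j)) \<longrightarrow> P \<omega>)"
    unfolding dunkl_sphere_def by (rule AE_density)
  also have "\<dots> \<longleftrightarrow> (AE \<omega> in surface_measure J. P \<omega>)"
    using * by (auto elim: eventually_elim2)
  finally show ?thesis .
qed

section \<open>Splitting a block of coordinates off Lebesgue measure\<close>

lemma measurable_vec_lambda [measurable (raw)]:
  assumes "\<And>j. (\<lambda>x. f x j) \<in> borel_measurable M"
  shows "(\<lambda>x. (\<chi> j. f x j) :: real ^ 'n) \<in> borel_measurable M"
proof (subst borel_measurable_euclidean_space, intro ballI)
  fix b :: "real ^ 'n" assume "b \<in> Basis"
  then obtain i where "b = axis i 1" by (auto simp: Basis_vec_def)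
  then show "(\<lambda>x. (\<chi> j. f x j) \<bullet> b) \<in> borel_measurable M"
    using assms[of i] by (simp add: inner_axis)
qed

lemma measurable_vec_nth [measurable]: "(\<lambda>x :: real ^ 'n. x $ i) \<in> borel_measurable borel"
  by (intro borel_measurable_continuous_onI continuous_intros)

text \<open>Bridge from vectors to coordinate functions, where \<open>merge\<close> can separate a
  block from its complement.\<close>

lemma lborel_vec_eq_PiM:
  "(lborel :: (real ^ 'n) measure) =
    distr (\<Pi>\<^sub>M j\<in>(UNIV :: 'n::finite set). lborel) borel (\<lambda>f. \<chi> j. f j)"
proof (rule lborel_eqI)
  interpret product_sigma_finite "\<lambda>_. lborel :: real measure"
    by (rule product_sigma_finite_lborel)
  interpret finite_product_sigma_finite "\<lambda>_. lborel :: real measure" "UNIV :: 'n set"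
    by standard simp
  fix l u :: "real ^ 'n" assume lu: "\<And>b. b \<in> Basis \<Longrightarrow> l \<bullet> b \<le> u \<bullet> b"
  have le: "l $ i \<le> u $ i" for i
    using lu[of "axis i 1"] by (auto simp: inner_axis Basis_vec_def)
  have "emeasure (distr (\<Pi>\<^sub>M j\<in>(UNIV :: 'n set). lborel) borel (\<lambda>f. \<chi> j. f j)) (box l u) =
      emeasure (\<Pi>\<^sub>M j\<in>(UNIV :: 'n set). lborel) ((\<lambda>f. \<chi> j. f j) -` box l u \<inter> space (\<Pi>\<^sub>M j\<in>(UNIV :: 'n set). lborel))"
    by (intro emeasure_distr) auto
  also have "(\<lambda>f. \<chi> j. f j) -` box l u \<inter> space (\<Pi>\<^sub>M j\<in>(UNIV :: 'n set). lborel) = Pi\<^sub>E UNIV (\<lambda>j. {l $ j<..<u $ j})"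
    by (auto simp: space_PiM PiE_iff mem_box Basis_vec_def inner_axis)
  also have "emeasure (\<Pi>\<^sub>M j\<in>(UNIV :: 'n set). lborel) \<dots> = (\<Prod>j\<in>UNIV. emeasure lborel {l $ j<..<u $ j})"
    by (intro measure_times) auto
  also have "\<dots> = ennreal (\<Prod>j\<in>UNIV. u $ j - l $ j)"
    using le by (simp add: prod_ennreal)
  also have "(\<Prod>j\<in>UNIV. u $ j - l $ j) = (\<Prod>b\<in>Basis. (u - l) \<bullet> b)"
    by (rule prod.reindex_bij_witness[of _ "\<lambda>b. THE j. b = axis j 1" "\<lambda>j. axis j 1"])
       (auto simp: Basis_vec_def inner_axis axis_eq_axis)
  finally show "emeasure (distr (\<Pi>\<^sub>M j\<in>(UNIV :: 'n set). lborel) borel (\<lambda>f. \<chi> j. f j)) (box l u) =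
    ennreal (\<Prod>b\<in>Basis. (u - l) \<bullet> b)" .
qed simp

text \<open>Cartesian counterpart of \<open>set_block\<close>, with \<open>y\<close> in the role of
  \<open>\<rho> \<omega>\<close>.\<close>

definition replace_block :: "'n::finite set \<Rightarrow> ('n \<Rightarrow> real) \<Rightarrow> real ^ 'n \<Rightarrow> real ^ 'n" where
  "replace_block J y x = (\<chi> j. if j \<in> J then y j else x $ j)"

text \<open>Tonelli for \<open>J\<close> and its complement. The coordinates of \<open>x\<close> in
  \<open>J\<close> are overwritten, so the outer quantifier over \<open>x\<close> contains a dummy
  one over the block, which has to be dropped.\<close>

lemma AE_replace_block_iff:
  fixes J :: "'n::finite set"
  assumes [measurable]: "Measurable.pred borel P"
  shows "(AE x in lborel. AE y in \<Pi>\<^sub>M j\<in>J. lborel. P (replace_block J y x)) \<longleftrightarrow> (AE x in lborel. P x)"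
proof -
  interpret product_sigma_finite "\<lambda>_. lborel :: real measure"
    by (rule product_sigma_finite_lborel)
  interpret J: finite_product_sigma_finite "\<lambda>_. lborel :: real measure" J
    by standard simp
  interpret K: finite_product_sigma_finite "\<lambda>_. lborel :: real measure" "-J"
    by standard simp
  let ?J = "\<Pi>\<^sub>M j\<in>J. lborel :: real measure" and ?K = "\<Pi>\<^sub>M j\<in>-J. lborel :: real measure"
  interpret pair_sigma_finite ?J ?K ..
  interpret UJ: pair_sigma_finite "lborel :: (real ^ 'n) measure" ?J ..
  have U: "(AE x in lborel. Q x) \<longleftrightarrow> (AE y in ?J. AE z in ?K. Q (\<chi> j. if j \<in> J then y j else z j))"
    if [measurable]: "Measurable.pred borel Q" for Q :: "real ^ 'n \<Rightarrow> bool"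
  proof -
    have D: "distr (?J \<Otimes>\<^sub>M ?K) (\<Pi>\<^sub>M j\<in>UNIV. lborel) (merge J (-J)) = (\<Pi>\<^sub>M j\<in>UNIV. lborel)"
      using distr_merge[of J "-J"] by simp
    have m[measurable]: "merge J (-J) \<in> ?J \<Otimes>\<^sub>M ?K \<rightarrow>\<^sub>M (\<Pi>\<^sub>M j\<in>UNIV. lborel)"
      using measurable_merge[of J "-J" "\<lambda>_. lborel"] by simp
    have "(AE x in lborel. Q x) \<longleftrightarrow> (AE f in \<Pi>\<^sub>M j\<in>UNIV. lborel. Q (\<chi> j. f j))"
      unfolding lborel_vec_eq_PiM by (subst AE_distr_iff) auto
    also have "\<dots> \<longleftrightarrow> (AE f in distr (?J \<Otimes>\<^sub>M ?K) (\<Pi>\<^sub>M j\<in>UNIV. lborel) (merge J (-J)). Q (\<chi> j. f j))"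
      by (simp only: D)
    also have "\<dots> \<longleftrightarrow> (AE w in ?J \<Otimes>\<^sub>M ?K. Q (\<chi> j. merge J (-J) (fst w, snd w) j))"
      by (subst AE_distr_iff) auto
    also have "\<dots> \<longleftrightarrow> (AE y in ?J. AE z in ?K. Q (\<chi> j. merge J (-J) (y, z) j))"
      by (rule AE_pair_iff[symmetric]) measurable
    also have "\<dots> \<longleftrightarrow> (AE y in ?J. AE z in ?K. Q (\<chi> j. if j \<in> J then y j else z j))"
    proof -
      have "(\<chi> j. merge J (-J) (y, z) j) = (\<chi> j. if j \<in> J then y j else z j)" for y z :: "'n \<Rightarrow> real"
        by (simp add: merge_def vec_eq_iff)
      then show ?thesis by (simp only:)
    qed
    finally show ?thesis .
  qed
  \<comment> \<open>Dropping the dummy quantifier requires a nonzero measure: the whole space has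
    mass \<open>top\<close>, or 1 if \<open>J\<close> is empty.\<close>
  have nz: "\<not> (AE y in ?J. False)"
  proof
    assume "AE y in ?J. False"
    then have "space ?J \<in> null_sets ?J" by (simp add: AE_iff_null_sets)
    moreover have "emeasure ?J (Pi\<^sub>E J (\<lambda>_. UNIV)) = (\<Prod>j\<in>J. \<infinity>)"
      by (subst J.measure_times) auto
    ultimately show False
      by (auto simp: null_sets_def space_PiM)
  qed
  have [measurable]: "(\<lambda>x. replace_block J (snd x) (fst x)) \<in> borel_measurable (lborel \<Otimes>\<^sub>M ?J)"
  proof -
    have "(\<lambda>x. if j \<in> J then snd x j else fst x $ j) \<in> borel_measurable (lborel \<Otimes>\<^sub>M ?J)" for j
      by (cases "j \<in> J") auto
    then show ?thesis unfolding replace_block_def by (rule measurable_vec_lambda)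
  qed
  have repl: "replace_block J y (\<chi> j. if j \<in> J then y' j else z j) = (\<chi> j. if j \<in> J then y j else z j)" for y y' z
    by (simp add: replace_block_def vec_eq_iff)
  have "(AE x in lborel. AE y in ?J. P (replace_block J y x)) \<longleftrightarrow>
      (AE y in ?J. AE x in lborel. P (replace_block J y x))"
    by (rule UJ.AE_commute) measurable
  also have "\<dots> \<longleftrightarrow> (AE y in ?J. AE y' in ?J. AE z in ?K. P (\<chi> j. if j \<in> J then y j else z j))"
  proof (rule AE_cong)
    fix y assume y: "y \<in> space ?J"
    have "(\<lambda>x. replace_block J (snd (x, y)) (fst (x, y))) \<in> borel_measurable lborel"
      by (rule measurable_compose[OF _ \<open>(\<lambda>x. replace_block J (snd x) (fst x)) \<in> _\<close>]) (use y in measurable)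
    then have [measurable]: "replace_block J y \<in> borel_measurable borel" by simp
    show "(AE x in lborel. P (replace_block J y x)) \<longleftrightarrow>
        (AE y' in ?J. AE z in ?K. P (\<chi> j. if j \<in> J then y j else z j))"
      by (subst U) (auto simp: repl)
  qed
  also have "\<dots> \<longleftrightarrow> (AE y in ?J. AE z in ?K. P (\<chi> j. if j \<in> J then y j else z j))"
  proof (rule AE_cong)
    fix y
    show "(AE y' in ?J. AE z in ?K. P (\<chi> j. if j \<in> J then y j else z j)) \<longleftrightarrow>
      (AE z in ?K. P (\<chi> j. if j \<in> J then y j else z j))"
      using nz by (cases "AE z in ?K. P (\<chi> j. if j \<in> J then y j else z j)") auto
  qed
  also have "\<dots> \<longleftrightarrow> (AE x in lborel. P x)"
    by (rule U[symmetric]) measurable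
  finally show ?thesis .
qed

text \<open>Moves null sets through one block of the mixed norm. Read from right to left it gives
  a.e. monotonicity of the norm; read from left to right it recovers a.e. statements from a
  vanishing norm.\<close>

lemma AE_set_block_iff:
  fixes J :: "'n::finite set"
  assumes J: "J \<noteq> {}" and [measurable]: "Measurable.pred borel P"
  shows "(AE x in lborel. AE \<rho> in lborel. 0 < \<rho> \<longrightarrow> (AE \<omega> in dunkl_sphere k J. P (set_block J \<rho> \<omega> x)))
    \<longleftrightarrow> (AE x in lborel. P x)"
proof -
  have "(AE \<rho> in lborel. 0 < \<rho> \<longrightarrow> (AE \<omega> in dunkl_sphere k J. P (set_block J \<rho> \<omega> x))) \<longleftrightarrow>
    (AE y in \<Pi>\<^sub>M j\<in>J. lborel. P (replace_block J y x))" for x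
  proof -
    have [measurable]: "(\<lambda>y. replace_block J y x) \<in> borel_measurable (\<Pi>\<^sub>M j\<in>J. lborel)"
    proof -
      have "(\<lambda>y. if j \<in> J then y j else x $ j) \<in> borel_measurable (\<Pi>\<^sub>M j\<in>J. lborel)" for j
        by (cases "j \<in> J") auto
      then show ?thesis unfolding replace_block_def by (rule measurable_vec_lambda)
    qed
    have "set_block J \<rho> \<omega> x = replace_block J (\<lambda>j\<in>J. \<rho> * \<omega> j) x" for \<rho> \<omega>
      by (simp add: set_block_def replace_block_def vec_eq_iff)
    then show ?thesis
      by (simp add: AE_dunkl_sphere_iff AE_polar_iff[of J "\<lambda>y. P (replace_block J y x)"] J)
  qed
  then show ?thesis by (simp add: AE_replace_block_iff)
qed

subsection \<open>Mixed norms of non-negative functions\<close>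

lemma space_dunkl_sphere: "space (dunkl_sphere k J) = unit_sphere J"
  by (auto simp: dunkl_sphere_def surface_measure_def space_scale_measure space_restrict_space
      space_PiM unit_sphere_def)

lemma measurable_dunkl_sphere:
  assumes "f \<in> (\<Pi>\<^sub>M j\<in>J. lborel) \<rightarrow>\<^sub>M N"
  shows "f \<in> dunkl_sphere k J \<rightarrow>\<^sub>M N"
  using measurable_surface_measure[OF assms] by (simp add: dunkl_sphere_def)

lemma measurable_dunkl_sphere_component:
  "j \<in> J \<Longrightarrow> (\<lambda>\<omega>. \<omega> j) \<in> borel_measurable (dunkl_sphere k J)"
  by (rule measurable_dunkl_sphere) measurable

lemma abs_le_L2_set:
  assumes "finite J" "j \<in> J"
  shows "\<bar>x j\<bar> \<le> L2_set x J"
  using member_le_L2_set[OF assms, of "\<lambda>j. \<bar>x j\<bar>"] by (simp add: L2_set_def)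

text \<open>The cone over the sphere lies in the cube with sides \<open>{-1..1}\<close>, and the
  weight is at most 1 there because the exponents are non-negative.\<close>

lemma emeasure_dunkl_sphere_finite:
  assumes J: "finite J" and k: "\<And>j. 0 \<le> k j"
  shows "emeasure (dunkl_sphere k J) (unit_sphere J) < \<infinity>"
proof -
  interpret product_sigma_finite "\<lambda>_. lborel :: real measure"
    by (rule product_sigma_finite_lborel)
  interpret finite_product_sigma_finite "\<lambda>_. lborel :: real measure" J
    by standard (rule J)
  note [measurable] = measurable_L2_set[OF J(1)]
  let ?D = "{x. 0 < L2_set x J \<and> L2_set x J < 1}"
  have sp: "space (surface_measure J) = unit_sphere J"
    using space_dunkl_sphere[of k J] by (simp add: dunkl_sphere_def)
  let ?R = "restrict_space (\<Pi>\<^sub>M j\<in>J. (lborel :: real measure)) ?D"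
  let ?S = "restrict_space (\<Pi>\<^sub>M j\<in>J. (lborel :: real measure)) (unit_sphere J)"
  have "{x \<in> space (\<Pi>\<^sub>M j\<in>J. lborel :: real measure). 0 < L2_set x J \<and> L2_set x J < 1} \<in> sets (\<Pi>\<^sub>M j\<in>J. lborel)"
    by measurable
  moreover have "{x \<in> space (\<Pi>\<^sub>M j\<in>J. lborel :: real measure). 0 < L2_set x J \<and> L2_set x J < 1} = ?D \<inter> space (\<Pi>\<^sub>M j\<in>J. lborel)"
    by auto
  ultimately have D: "?D \<inter> space (\<Pi>\<^sub>M j\<in>J. lborel) \<in> sets (\<Pi>\<^sub>M j\<in>J. lborel)"
    by simp
  have "emeasure ?R (space ?R) = emeasure (\<Pi>\<^sub>M j\<in>J. lborel) (?D \<inter> space (\<Pi>\<^sub>M j\<in>J. lborel))"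
    unfolding space_restrict_space by (rule emeasure_restrict_space[OF D]) auto
  also have "\<dots> \<le> emeasure (\<Pi>\<^sub>M j\<in>J. lborel) (Pi\<^sub>E J (\<lambda>_. {-1..1::real}))"
  proof (rule emeasure_mono)
    show "?D \<inter> space (\<Pi>\<^sub>M j\<in>J. lborel) \<subseteq> Pi\<^sub>E J (\<lambda>_. {-1..1})"
    proof
      fix x assume x: "x \<in> ?D \<inter> space (\<Pi>\<^sub>M j\<in>J. lborel :: real measure)"
      have "-1 \<le> x j \<and> x j \<le> 1" if "j \<in> J" for j
        using abs_le_L2_set[OF J that, of x] x by auto
      then show "x \<in> Pi\<^sub>E J (\<lambda>_. {-1..1})" using x by (auto simp: space_PiM PiE_iff)
    qed
  qed (use J in \<open>auto intro!: sets_PiM_I_finite\<close>)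
  also have "\<dots> = (\<Prod>j\<in>J. emeasure lborel {-1..1::real})"
    by (intro measure_times) auto
  also have "\<dots> < \<infinity>" by (simp add: ennreal_power[symmetric] power_less_top_ennreal)
  finally have fin: "emeasure ?R (space ?R) < \<infinity>" .
  have S: "space ?S = unit_sphere J"
    by (auto simp: space_restrict_space space_PiM unit_sphere_def)
  have "emeasure (surface_measure J) (unit_sphere J) =
      of_nat (card J) * emeasure (distr ?R ?S (\<lambda>x. \<lambda>j\<in>J. x j / L2_set x J)) (space ?S)"
    unfolding surface_measure_def emeasure_scale_measure S ..
  also have "\<dots> \<le> of_nat (card J) * emeasure ?R (space ?R)"
    unfolding emeasure_distr[OF measurable_normalise[OF J] sets.top] by (intro mult_left_mono emeasure_mono) auto
  also have "\<dots> < \<infinity>" using fin by (simp add: ennreal_mult_less_top of_nat_less_top)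
  finally have fin2: "emeasure (surface_measure J) (unit_sphere J) < \<infinity>" .
  have [measurable]: "(\<lambda>\<omega>. ennreal (\<Prod>j\<in>J. \<bar>\<omega> j\<bar> powr (2 * k j))) \<in> borel_measurable (surface_measure J)"
    by (rule measurable_surface_measure) measurable
  have "emeasure (dunkl_sphere k J) (unit_sphere J) =
      (\<integral>\<^sup>+\<omega>. ennreal (\<Prod>j\<in>J. \<bar>\<omega> j\<bar> powr (2 * k j)) * indicator (space (surface_measure J)) \<omega> \<partial>surface_measure J)"
    unfolding dunkl_sphere_def sp[symmetric] by (intro emeasure_density) auto
  also have "\<dots> \<le> (\<integral>\<^sup>+\<omega>. 1 \<partial>surface_measure J)"
  proof (rule nn_integral_mono)
    fix \<omega> assume "\<omega> \<in> space (surface_measure J)"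
    then have "L2_set \<omega> J = 1" by (simp add: sp unit_sphere_def)
    then have "(\<Prod>j\<in>J. \<bar>\<omega> j\<bar> powr (2 * k j)) \<le> 1"
      using abs_le_L2_set[OF J, of _ \<omega>] k by (intro prod_le_1) (auto intro!: powr_le1)
    then show "ennreal (\<Prod>j\<in>J. \<bar>\<omega> j\<bar> powr (2 * k j)) * indicator (space (surface_measure J)) \<omega> \<le> 1"
      by (auto simp: indicator_def)
  qed
  also have "\<dots> = emeasure (surface_measure J) (unit_sphere J)" by (simp add: sp)
  finally show ?thesis using fin2 by simp
qed

lemma sigma_finite_dunkl_sphere:
  assumes "finite J" "\<And>j. 0 \<le> k j"
  shows "sigma_finite_measure (dunkl_sphere k J)"
proof -
  have "finite_measure (dunkl_sphere k J)"
    using emeasure_dunkl_sphere_finite[of J k] assms by (intro finite_measureI) (auto simp: space_dunkl_sphere)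
  then show ?thesis by (simp add: finite_measure_def)
qed

lemma measurable_set_block [measurable (raw)]:
  fixes x :: "'z \<Rightarrow> real ^ 'n::finite"
  assumes [measurable]: "\<rho> \<in> borel_measurable M" "x \<in> borel_measurable M"
    and "\<omega> \<in> M \<rightarrow>\<^sub>M dunkl_sphere k J"
  shows "(\<lambda>z. set_block J (\<rho> z) (\<omega> z) (x z)) \<in> borel_measurable M"
proof -
  have "(\<lambda>z. if j \<in> J then \<rho> z * \<omega> z j else x z $ j) \<in> borel_measurable M" for j
    using measurable_compose[OF assms(3) measurable_dunkl_sphere_component, of j] by (cases "j \<in> J") auto
  then show ?thesis unfolding set_block_def by (rule measurable_vec_lambda)
qed

definition rad_measure :: "('n \<Rightarrow> real) \<Rightarrow> 'n set \<Rightarrow> real measure" where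
  "rad_measure k J = density lborel (\<lambda>\<rho>. ennreal (\<rho> powr (hom_dim k J - 1) * indicator {0<..} \<rho>))"

lemma sigma_finite_rad_measure: "sigma_finite_measure (rad_measure k J)"
  unfolding rad_measure_def by (subst sigma_finite_measure.sigma_finite_iff_density_finite[OF sigma_finite_lborel]) auto

lemma rad_norm_eq_Lp_norm:
  assumes [measurable]: "F \<in> borel_measurable borel"
  shows "rad_norm k J s F = Lp_norm (rad_measure k J) s F"
  unfolding rad_norm_def Lp_norm_def rad_measure_def
  by (subst nn_integral_density)
     (auto intro!: arg_cong[where f="\<lambda>z. enn_powr z _"] nn_integral_cong simp: indicator_def ac_simps)

lemma ang_norm_eq_Lp_norm: "ang_norm k J s F = Lp_norm (dunkl_sphere k J) s F"
  by (simp add: ang_norm_def Lp_norm_def)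

text \<open>The factor \<open>c\<close> may be infinite. The lower bound for the Hardy operator uses
  this freedom, since finiteness of the truncated integral is only a consequence of it.\<close>

lemma Lp_norm_cmult:
  assumes [measurable]: "F \<in> borel_measurable \<mu>" and "s \<noteq> 0"
  shows "Lp_norm \<mu> s (\<lambda>x. c * F x) = c * Lp_norm \<mu> s F"
  using assms(2) by (simp add: Lp_norm_def enn_powr_mult nn_integral_cmult enn_powr_inverse_cancel)

lemma Lp_norm_mono_AE:
  assumes "AE x in \<mu>. F x \<le> G x" "0 < s"
  shows "Lp_norm \<mu> s F \<le> Lp_norm \<mu> s G"
  unfolding Lp_norm_def using assms
  by (intro enn_powr_mono nn_integral_mono_AE) (auto elim!: eventually_mono intro: enn_powr_mono)

text \<open>Derived from the definition and not via \<open>rad_norm_eq_Lp_norm\<close>, which asks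
  for measurable arguments; sections of Lebesgue measurable functions may fail to be
  measurable.\<close>

lemma rad_norm_mono_AE:
  assumes "AE \<rho> in lborel. 0 < \<rho> \<longrightarrow> F \<rho> \<le> G \<rho>" "0 < s"
  shows "rad_norm k J s F \<le> rad_norm k J s G"
  unfolding rad_norm_def using assms
  by (intro enn_powr_mono nn_integral_mono_AE)
     (auto elim!: eventually_mono intro!: mult_right_mono enn_powr_mono simp: indicator_def)

lemma rad_norm_mono:
  assumes "\<And>\<rho>. 0 < \<rho> \<Longrightarrow> F \<rho> \<le> G \<rho>" "0 < s"
  shows "rad_norm k J s F \<le> rad_norm k J s G"
  using assms by (intro rad_norm_mono_AE) auto

lemma ang_norm_mono:
  assumes "\<And>\<omega>. \<omega> \<in> unit_sphere J \<Longrightarrow> F \<omega> \<le> G \<omega>" "0 < s"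
  shows "ang_norm k J s F \<le> ang_norm k J s G"
  unfolding ang_norm_eq_Lp_norm using assms
  by (intro Lp_norm_mono_AE AE_I2) (auto simp: space_dunkl_sphere)

lemma rad_norm_eq_0_AE:
  assumes [measurable]: "F \<in> borel_measurable borel" and "rad_norm k J s F = 0"
  shows "AE \<rho> in lborel. 0 < \<rho> \<longrightarrow> F \<rho> = 0"
proof -
  have "(\<integral>\<^sup>+\<rho>\<in>{0<..}. (enn_powr (F \<rho>) s * ennreal (\<rho> powr (hom_dim k J - 1))) \<partial>lborel) = 0"
    using assms(2) by (simp add: rad_norm_def)
  then have "AE \<rho> in lborel. enn_powr (F \<rho>) s * ennreal (\<rho> powr (hom_dim k J - 1)) * indicator {0<..} \<rho> = 0"
    by (subst (asm) nn_integral_0_iff_AE) auto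
  then show ?thesis by (auto elim!: eventually_mono simp: indicator_def)
qed

text \<open>Under the substitution the Lebesgue measure contributes \<open>1 / t\<close> and the
  weight \<open>t powr (1 - hom_dim k J)\<close>; the outer root then divides the total exponent by
  \<open>s\<close>.\<close>

lemma rad_norm_dilation:
  assumes [measurable]: "F \<in> borel_measurable borel" and t: "0 < t" and s: "0 < s"
  shows "rad_norm k J s (\<lambda>\<rho>. F (t * \<rho>)) = ennreal (t powr (- (hom_dim k J / s))) * rad_norm k J s F"
proof -
  let ?N = "hom_dim k J"
  define g where "g \<rho> = enn_powr (F \<rho>) s * ennreal (\<rho> powr (?N - 1)) * indicator {0<..} \<rho>" for \<rho>
  have [measurable]: "g \<in> borel_measurable borel" unfolding g_def by measurable
  have g: "enn_powr (F (t * \<rho>)) s * ennreal (\<rho> powr (?N - 1)) * indicator {0<..} \<rho>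
      = ennreal (t powr (1 - ?N)) * g (t * \<rho>)" for \<rho>
  proof (cases "0 < \<rho>")
    case True
    have "\<rho> powr (?N - 1) = t powr (1 - ?N) * (t * \<rho>) powr (?N - 1)"
      using t True by (simp add: powr_mult powr_add[symmetric] mult.assoc[symmetric])
    then show ?thesis
      using t True by (simp add: g_def ennreal_mult ac_simps)
  qed (use t in \<open>auto simp: g_def indicator_def zero_less_mult_iff\<close>)
  have "(\<integral>\<^sup>+\<rho>. g \<rho> \<partial>lborel) = ennreal t * (\<integral>\<^sup>+\<rho>. g (t * \<rho>) \<partial>lborel)"
    using nn_integral_real_affine[of g t 0] t by simp
  then have "(\<integral>\<^sup>+\<rho>. g (t * \<rho>) \<partial>lborel) = ennreal (1 / t) * (\<integral>\<^sup>+\<rho>. g \<rho> \<partial>lborel)"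
    using t by (simp add: mult.assoc[symmetric] ennreal_mult[symmetric])
  then have "rad_norm k J s (\<lambda>\<rho>. F (t * \<rho>)) =
      enn_powr (ennreal (t powr (1 - ?N)) * (ennreal (1 / t) * (\<integral>\<^sup>+\<rho>. g \<rho> \<partial>lborel))) (1 / s)"
    unfolding rad_norm_def g by (simp add: nn_integral_cmult)
  also have "ennreal (t powr (1 - ?N)) * (ennreal (1 / t) * (\<integral>\<^sup>+\<rho>. g \<rho> \<partial>lborel)) =
      ennreal (t powr (- ?N)) * (\<integral>\<^sup>+\<rho>. g \<rho> \<partial>lborel)"
  proof -
    have "t powr (1 - ?N) * (1 / t) = t powr (- ?N)"
      using t by (simp add: powr_diff powr_minus divide_inverse)
    then show ?thesis
      using t by (simp add: mult.assoc[symmetric] ennreal_mult[symmetric])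
  qed
  finally show ?thesis
    using t s by (simp add: enn_powr_mult enn_powr_ennreal powr_powr rad_norm_def g_def)
qed

text \<open>\<open>partial_norm\<close> with an arbitrary \<open>ennreal\<close>-valued function in
  place of the modulus: the majorant of the Hardy operator may take the value infinity.\<close>

primrec block_norm :: "('n::finite \<Rightarrow> nat) \<Rightarrow> ('n \<Rightarrow> real) \<Rightarrow> (nat \<Rightarrow> real) \<Rightarrow> (nat \<Rightarrow> real) \<Rightarrow>
    (real ^ 'n \<Rightarrow> ennreal) \<Rightarrow> nat \<Rightarrow> real ^ 'n \<Rightarrow> ennreal" where
  "block_norm \<beta> k p q F 0 = F"
| "block_norm \<beta> k p q F (Suc i) = (\<lambda>x.
     rad_norm k (block \<beta> (Suc i)) (p (Suc i)) (\<lambda>\<rho>.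
       ang_norm k (block \<beta> (Suc i)) (q (Suc i)) (\<lambda>\<omega>.
         block_norm \<beta> k p q F i (set_block (block \<beta> (Suc i)) \<rho> \<omega> x))))"

lemma partial_norm_eq_block_norm:
  "partial_norm \<beta> k p q f i = block_norm \<beta> k p q (\<lambda>x. ennreal (cmod (f x))) i"
  by (induction i) auto

lemma block_norm_cong_point:
  assumes "\<And>j. \<beta> j \<notin> {1..i} \<Longrightarrow> x $ j = y $ j"
  shows "block_norm \<beta> k p q F i x = block_norm \<beta> k p q F i y"
  using assms
proof (induction i arbitrary: x y)
  case 0
  then have "x = y" by (simp add: vec_eq_iff)
  then show ?case by simp
next
  case (Suc i)
  have "block_norm \<beta> k p q F i (set_block (block \<beta> (Suc i)) \<rho> \<omega> x) =
      block_norm \<beta> k p q F i (set_block (block \<beta> (Suc i)) \<rho> \<omega> y)" for \<rho> \<omega>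
    by (rule Suc.IH) (auto simp: set_block_def block_def intro!: Suc.prems)
  then show ?case by simp
qed

text \<open>\<open>AE_set_block_iff\<close> speaks of Borel predicates only; this replaces an
  arbitrary a.e. property by a stronger measurable one.\<close>

lemma AE_ex_measurable_pred:
  assumes "AE x in M. Q x"
  obtains P where "Measurable.pred M P" "AE x in M. P x" "\<And>x. x \<in> space M \<Longrightarrow> P x \<Longrightarrow> Q x"
proof -
  from assms obtain N where N: "{x \<in> space M. \<not> Q x} \<subseteq> N" "emeasure M N = 0" "N \<in> sets M"
    by (rule AE_E)
  have "Measurable.pred M (\<lambda>x. x \<notin> N)" using N by measurable
  moreover have "AE x in M. x \<notin> N" using N by (intro AE_not_in) auto
  ultimately show ?thesis using N that[of "\<lambda>x. x \<notin> N"] by blast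
qed

lemma AE_lborel_ex:
  assumes "AE x in lborel. Q (x :: 'a::euclidean_space)"
  shows "\<exists>x. Q x"
  using assms by (rule eventually_happens'[rotated]) (simp add: ae_filter_eq_bot_iff)

section \<open>Monotonicity, Minkowski, scaling and null functions for the iterated norm\<close>

locale mixed_norm_setting =
  fixes \<beta> :: "'n::finite \<Rightarrow> nat" and m :: nat and k :: "'n \<Rightarrow> real" and p q :: "nat \<Rightarrow> real"
  assumes range_\<beta>: "range \<beta> = {1..m}"
    and k_nonneg: "\<And>j. 0 \<le> k j"
    and p_gt_1: "\<And>i. i \<in> {1..m} \<Longrightarrow> 1 < p i"
    and q_gt_1: "\<And>i. i \<in> {1..m} \<Longrightarrow> 1 < q i"
begin

abbreviation "bnorm \<equiv> block_norm \<beta> k p q"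

lemma block_nonempty: "i \<in> {1..m} \<Longrightarrow> block \<beta> i \<noteq> {}"
proof -
  assume "i \<in> {1..m}"
  then have "i \<in> range \<beta>" by (simp add: range_\<beta>)
  then show ?thesis by (auto simp: block_def)
qed

lemma p_pos: "i \<in> {1..m} \<Longrightarrow> 0 < p i" and q_pos: "i \<in> {1..m} \<Longrightarrow> 0 < q i"
  using p_gt_1 q_gt_1 by force+

lemma bnorm_full: "bnorm F m x = bnorm F m y"
  using range_\<beta> by (intro block_norm_cong_point) auto

text \<open>Neither function is assumed measurable: \<open>nn_integral\<close> is monotone for all
  functions, and only the exceptional set has to be made Borel. This allows a Lebesgue measurable
  function to be exchanged for a Borel one under the norm.\<close>

lemma bnorm_mono_AE_partial:
  assumes "AE x in lborel. F x \<le> G x" "i \<le> m"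
  shows "AE x in lborel. bnorm F i x \<le> bnorm G i x"
  using assms(2)
proof (induction i)
  case 0
  then show ?case using assms(1) by simp
next
  case (Suc i)
  have i: "Suc i \<in> {1..m}" using Suc by auto
  let ?J = "block \<beta> (Suc i)"
  have "AE x in lborel. bnorm F i x \<le> bnorm G i x" using Suc by simp
  then obtain P where P: "Measurable.pred lborel P" "AE x in lborel. P x"
    "\<And>x. x \<in> space lborel \<Longrightarrow> P x \<Longrightarrow> bnorm F i x \<le> bnorm G i x" by (rule AE_ex_measurable_pred) blast
  then have "Measurable.pred borel P" by simp
  then have "AE x in lborel. AE \<rho> in lborel. 0 < \<rho> \<longrightarrow> (AE \<omega> in dunkl_sphere k ?J. P (set_block ?J \<rho> \<omega> x))"
    using AE_set_block_iff[OF block_nonempty[OF i]] P(2) by blast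
  then show ?case
  proof eventually_elim
    case (elim x)
    show ?case unfolding block_norm.simps
    proof (rule rad_norm_mono_AE[OF _ p_pos[OF i]])
      show "AE \<rho> in lborel. 0 < \<rho> \<longrightarrow>
         ang_norm k ?J (q (Suc i)) (\<lambda>\<omega>. bnorm F i (set_block ?J \<rho> \<omega> x))
         \<le> ang_norm k ?J (q (Suc i)) (\<lambda>\<omega>. bnorm G i (set_block ?J \<rho> \<omega> x))"
        using elim
      proof eventually_elim
        case (elim \<rho>)
        show ?case
          unfolding ang_norm_eq_Lp_norm using elim P(3) q_pos[OF i]
          by (auto intro!: Lp_norm_mono_AE elim!: eventually_mono)
      qed
    qed
  qed
qed

lemma bnorm_mono_AE:
  assumes "AE x in lborel. F x \<le> G x"
  shows "bnorm F m 0 \<le> bnorm G m 0"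
proof -
  \<comment> \<open>After \<open>m\<close> blocks the norm is constant in the point, so one good
    point suffices.\<close>
  obtain x where "bnorm F m x \<le> bnorm G m x"
    using AE_lborel_ex[OF bnorm_mono_AE_partial[OF assms]] by auto
  then show ?thesis by (metis bnorm_full)
qed

lemma bnorm_mono: "(\<And>x. F x \<le> G x) \<Longrightarrow> bnorm F m 0 \<le> bnorm G m 0"
  by (intro bnorm_mono_AE) auto

text \<open>The parameter in \<open>M\<close> carries the integration variable of Minkowski's
  inequality through all blocks; Tonelli needs joint measurability at each level.\<close>

lemma measurable_bnorm_pair:
  assumes "(\<lambda>z. F (fst z) (snd z)) \<in> borel_measurable (M \<Otimes>\<^sub>M borel)"
  shows "(\<lambda>z. bnorm (F (fst z)) i (snd z)) \<in> borel_measurable (M \<Otimes>\<^sub>M borel)"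
proof (induction i)
  case 0
  then show ?case using assms by simp
next
  case (Suc i)
  let ?J = "block \<beta> (Suc i)"
  interpret S: sigma_finite_measure "dunkl_sphere k ?J"
    using k_nonneg by (intro sigma_finite_dunkl_sphere) auto
  have [measurable]: "(\<lambda>w. bnorm (F (fst (fst (fst w)))) i (set_block ?J (snd (fst w)) (snd w) (snd (fst (fst w)))))
    \<in> borel_measurable (((M \<Otimes>\<^sub>M borel) \<Otimes>\<^sub>M lborel) \<Otimes>\<^sub>M dunkl_sphere k ?J)"
    by (rule measurable_compose[OF _ Suc, of "\<lambda>w. (fst (fst (fst w)), set_block ?J (snd (fst w)) (snd w) (snd (fst (fst w))))", simplified]) measurable
  show ?case
    unfolding block_norm.simps rad_norm_def ang_norm_def by measurable
qed

lemma measurable_bnorm_Pair1: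
  assumes "(\<lambda>z. F (fst z) (snd z)) \<in> borel_measurable (M \<Otimes>\<^sub>M borel)"
    and "f \<in> A \<rightarrow>\<^sub>M M" "g \<in> A \<rightarrow>\<^sub>M borel"
  shows "(\<lambda>a. bnorm (F (f a)) i (g a)) \<in> borel_measurable A"
proof -
  have "(\<lambda>a. (f a, g a)) \<in> A \<rightarrow>\<^sub>M M \<Otimes>\<^sub>M borel" using assms by measurable
  from measurable_compose[OF this measurable_bnorm_pair[OF assms(1), of i]] show ?thesis by simp
qed

lemma measurable_bnorm [measurable]:
  assumes "F \<in> borel_measurable borel"
  shows "bnorm F i \<in> borel_measurable borel"
  using assms measurable_bnorm_Pair1[of "\<lambda>_. F" "count_space UNIV :: unit measure" "\<lambda>_. ()" borel "\<lambda>x. x"]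
  by (simp add: measurable_compose[OF measurable_snd])

lemma measurable_ang_bnorm [measurable]:
  assumes [measurable]: "F \<in> borel_measurable borel"
  shows "(\<lambda>\<rho>. ang_norm k J s (\<lambda>\<omega>. bnorm F i (set_block J \<rho> \<omega> x))) \<in> borel_measurable borel"
proof -
  interpret S: sigma_finite_measure "dunkl_sphere k J"
    using k_nonneg by (intro sigma_finite_dunkl_sphere) auto
  show ?thesis unfolding ang_norm_def by measurable
qed

text \<open>Each block uses Minkowski twice: on the sphere, which moves the integral outside the
  angular norm \<open>A t \<rho>\<close>, and then in the radius.\<close>

lemma bnorm_nn_integral_le:
  assumes \<nu>: "sigma_finite_measure \<nu>"
    and G: "(\<lambda>z. G (fst z) (snd z)) \<in> borel_measurable (\<nu> \<Otimes>\<^sub>M borel)"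
    and i: "i \<le> m"
  shows "bnorm (\<lambda>x. \<integral>\<^sup>+t. G t x \<partial>\<nu>) i x \<le> (\<integral>\<^sup>+t. bnorm (G t) i x \<partial>\<nu>)"
  using i
proof (induction i arbitrary: x)
  case (Suc i)
  interpret \<nu>: sigma_finite_measure \<nu> by fact
  have i: "Suc i \<in> {1..m}" using Suc by auto
  let ?J = "block \<beta> (Suc i)"
  have S: "sigma_finite_measure (dunkl_sphere k ?J)"
    using k_nonneg by (intro sigma_finite_dunkl_sphere) auto
  interpret S: sigma_finite_measure "dunkl_sphere k ?J" by (rule S)
  define A where "A t \<rho> = ang_norm k ?J (q (Suc i)) (\<lambda>\<omega>. bnorm (G t) i (set_block ?J \<rho> \<omega> x))" for t \<rho>
  have m3: "(\<lambda>w. bnorm (G (fst (fst w))) i (set_block ?J (snd (fst w)) (snd w) x))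
      \<in> borel_measurable ((\<nu> \<Otimes>\<^sub>M borel) \<Otimes>\<^sub>M dunkl_sphere k ?J)"
    by (rule measurable_bnorm_Pair1[OF G]) measurable
  have A_meas: "(\<lambda>z. A (fst z) (snd z)) \<in> borel_measurable (\<nu> \<Otimes>\<^sub>M borel)"
    unfolding A_def ang_norm_def using m3 by measurable
  have rm: "sets (rad_measure k ?J) = sets borel" by (simp add: rad_measure_def)
  have "bnorm (\<lambda>x. \<integral>\<^sup>+t. G t x \<partial>\<nu>) (Suc i) x \<le>
      rad_norm k ?J (p (Suc i)) (\<lambda>\<rho>. ang_norm k ?J (q (Suc i)) (\<lambda>\<omega>. \<integral>\<^sup>+t. bnorm (G t) i (set_block ?J \<rho> \<omega> x) \<partial>\<nu>))"
    using Suc p_pos[OF i] q_pos[OF i] unfolding block_norm.simps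
    by (intro rad_norm_mono ang_norm_mono) auto
  also have "\<dots> \<le> rad_norm k ?J (p (Suc i)) (\<lambda>\<rho>. \<integral>\<^sup>+t. A t \<rho> \<partial>\<nu>)"
  proof (rule rad_norm_mono[OF _ p_pos[OF i]])
    fix \<rho> :: real
    have "(\<lambda>w. bnorm (G (fst w)) i (set_block ?J \<rho> (snd w) x)) \<in> borel_measurable (\<nu> \<Otimes>\<^sub>M dunkl_sphere k ?J)"
      by (rule measurable_bnorm_Pair1[OF G]) measurable
    then show "ang_norm k ?J (q (Suc i)) (\<lambda>\<omega>. \<integral>\<^sup>+t. bnorm (G t) i (set_block ?J \<rho> \<omega> x) \<partial>\<nu>) \<le> (\<integral>\<^sup>+t. A t \<rho> \<partial>\<nu>)"
      unfolding A_def ang_norm_eq_Lp_norm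
      by (intro Lp_norm_nn_integral_le[OF \<nu> S]) (auto simp: case_prod_beta' q_gt_1[OF i])
  qed
  also have "\<dots> = Lp_norm (rad_measure k ?J) (p (Suc i)) (\<lambda>\<rho>. \<integral>\<^sup>+t. A t \<rho> \<partial>\<nu>)"
  proof (rule rad_norm_eq_Lp_norm)
    have "(\<lambda>w. A (snd w) (fst w)) \<in> borel_measurable (borel \<Otimes>\<^sub>M \<nu>)"
      using measurable_compose[OF _ A_meas, of "\<lambda>w. (snd w, fst w)" "borel \<Otimes>\<^sub>M \<nu>"] by simp
    then show "(\<lambda>\<rho>. \<integral>\<^sup>+t. A t \<rho> \<partial>\<nu>) \<in> borel_measurable borel"
      by measurable
  qed
  also have "\<dots> \<le> (\<integral>\<^sup>+t. Lp_norm (rad_measure k ?J) (p (Suc i)) (A t) \<partial>\<nu>)"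
  proof (rule Lp_norm_nn_integral_le[OF \<nu> sigma_finite_rad_measure _ p_gt_1[OF i]])
    show "case_prod A \<in> borel_measurable (\<nu> \<Otimes>\<^sub>M rad_measure k ?J)"
      using A_meas by (simp add: case_prod_beta' measurable_cong_sets[OF sets_pair_measure_cong[OF refl rm] refl])
  qed
  also have "\<dots> = (\<integral>\<^sup>+t. bnorm (G t) (Suc i) x \<partial>\<nu>)"
  proof (rule nn_integral_cong)
    fix t assume "t \<in> space \<nu>"
    then have "A t \<in> borel_measurable borel"
      using measurable_compose[OF measurable_Pair1' A_meas] by simp
    then show "Lp_norm (rad_measure k ?J) (p (Suc i)) (A t) = bnorm (G t) (Suc i) x"
      by (simp add: rad_norm_eq_Lp_norm[symmetric]) (simp add: A_def[abs_def])
  qed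
  finally show ?case .
qed simp

lemma bnorm_cmult:
  assumes [measurable]: "F \<in> borel_measurable borel" and "i \<le> m"
  shows "bnorm (\<lambda>x. c * F x) i x = c * bnorm F i x"
  using assms(2)
proof (induction i arbitrary: x)
  case (Suc i)
  have i: "Suc i \<in> {1..m}" using Suc by auto
  let ?J = "block \<beta> (Suc i)"
  have "ang_norm k ?J (q (Suc i)) (\<lambda>\<omega>. c * bnorm F i (set_block ?J \<rho> \<omega> x)) =
      c * ang_norm k ?J (q (Suc i)) (\<lambda>\<omega>. bnorm F i (set_block ?J \<rho> \<omega> x))" for \<rho>
    unfolding ang_norm_eq_Lp_norm using q_pos[OF i] by (intro Lp_norm_cmult) auto
  moreover have "rad_norm k ?J (p (Suc i)) (\<lambda>\<rho>. c * ang_norm k ?J (q (Suc i)) (\<lambda>\<omega>. bnorm F i (set_block ?J \<rho> \<omega> x)))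
    = c * rad_norm k ?J (p (Suc i)) (\<lambda>\<rho>. ang_norm k ?J (q (Suc i)) (\<lambda>\<omega>. bnorm F i (set_block ?J \<rho> \<omega> x)))"
    using p_pos[OF i] by (simp add: rad_norm_eq_Lp_norm Lp_norm_cmult rad_measure_def)
  ultimately show ?case using Suc by simp
qed simp

text \<open>Dilating a point in polar form multiplies the radius and leaves the direction alone, so
  only the radial norms contribute, the \<open>j\<close>-th one with its own homogeneous dimension
  divided by \<open>p j\<close>.\<close>

lemma bnorm_dilation:
  assumes [measurable]: "F \<in> borel_measurable borel" and t: "0 < t" and "i \<le> m"
  shows "bnorm (\<lambda>x. F (t *\<^sub>R x)) i x =
    ennreal (t powr (- (\<Sum>j = 1..i. hom_dim k (block \<beta> j) / p j))) * bnorm F i (t *\<^sub>R x)"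
  using assms(3)
proof (induction i arbitrary: x)
  case (Suc i)
  have i: "Suc i \<in> {1..m}" using Suc by auto
  let ?J = "block \<beta> (Suc i)"
  let ?c = "t powr (- (\<Sum>j = 1..i. hom_dim k (block \<beta> j) / p j))"
  define A where "A \<rho> = ang_norm k ?J (q (Suc i)) (\<lambda>\<omega>. bnorm F i (set_block ?J \<rho> \<omega> (t *\<^sub>R x)))" for \<rho>
  have A[measurable]: "A \<in> borel_measurable borel" unfolding A_def by measurable
  have sb: "t *\<^sub>R set_block ?J \<rho> \<omega> x = set_block ?J (t * \<rho>) \<omega> (t *\<^sub>R x)" for \<rho> \<omega>
    by (simp add: set_block_def vec_eq_iff)
  have "ang_norm k ?J (q (Suc i)) (\<lambda>\<omega>. bnorm (\<lambda>x. F (t *\<^sub>R x)) i (set_block ?J \<rho> \<omega> x)) = ennreal ?c * A (t * \<rho>)" for \<rho>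
    unfolding A_def ang_norm_eq_Lp_norm using q_pos[OF i] Suc
    by (simp add: sb) (intro Lp_norm_cmult, auto)
  then have "bnorm (\<lambda>x. F (t *\<^sub>R x)) (Suc i) x = rad_norm k ?J (p (Suc i)) (\<lambda>\<rho>. ennreal ?c * A (t * \<rho>))"
    by simp
  also have "\<dots> = ennreal ?c * rad_norm k ?J (p (Suc i)) (\<lambda>\<rho>. A (t * \<rho>))"
    using p_pos[OF i] by (simp add: rad_norm_eq_Lp_norm Lp_norm_cmult rad_measure_def)
  also have "\<dots> = ennreal ?c * (ennreal (t powr (- (hom_dim k ?J / p (Suc i)))) * rad_norm k ?J (p (Suc i)) A)"
    by (simp add: rad_norm_dilation[OF A t p_pos[OF i]])
  also have "rad_norm k ?J (p (Suc i)) A = bnorm F (Suc i) (t *\<^sub>R x)" by (simp add: A_def[abs_def])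
  finally show ?case
    using t by (simp add: mult.assoc[symmetric] ennreal_mult[symmetric] powr_add[symmetric])
qed (use t in simp)

text \<open>Descends from the outermost block: a vanishing radial norm makes the angular norm zero
  for almost every radius, hence the integrand zero on almost every direction, and the polar
  statement is turned back into one about almost every point.\<close>

lemma bnorm_eq_0_imp:
  assumes [measurable]: "F \<in> borel_measurable borel" and "bnorm F m 0 = 0"
  shows "AE x in lborel. F x = 0"
proof -
  have "AE x in lborel. bnorm F (m - d) x = 0" if "d \<le> m" for d
    using that
  proof (induction d)
    case 0
    have "bnorm F m x = 0" for x using assms(2) bnorm_full[of F x 0] by simp
    then show ?case by simp
  next
    case (Suc d)
    define i where "i = m - Suc d"
    have si: "m - d = Suc i" and i: "Suc i \<in> {1..m}" using Suc by (auto simp: i_def)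
    let ?J = "block \<beta> (Suc i)"
    have "AE x in lborel. bnorm F (Suc i) x = 0" using Suc si by simp
    then have "AE x in lborel. AE \<rho> in lborel. 0 < \<rho> \<longrightarrow> (AE \<omega> in dunkl_sphere k ?J. bnorm F i (set_block ?J \<rho> \<omega> x) = 0)"
    proof eventually_elim
      case (elim x)
      then have "AE \<rho> in lborel. 0 < \<rho> \<longrightarrow>
          ang_norm k ?J (q (Suc i)) (\<lambda>\<omega>. bnorm F i (set_block ?J \<rho> \<omega> x)) = 0"
        by (intro rad_norm_eq_0_AE) auto
      then show ?case
      proof eventually_elim
        case (elim \<rho>)
        then show ?case by (auto simp: ang_norm_def nn_integral_0_iff_AE)
      qed
    qed
    then show ?case
      using AE_set_block_iff[OF block_nonempty[OF i], of "\<lambda>x. bnorm F i x = 0" k] by (simp add: i_def)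
  qed
  from this[of m] show ?thesis by simp
qed

text \<open>The function \<open>G\<close> that is infinite where \<open>F\<close> is, and 0
  elsewhere, satisfies \<open>2 * G x = G x\<close>. Its norm is finite and equals its own double,
  so it is 0.\<close>

lemma bnorm_finite_imp:
  assumes [measurable]: "F \<in> borel_measurable borel" and "bnorm F m 0 < \<infinity>"
  shows "AE x in lborel. F x < \<infinity>"
proof -
  define G where "G x = (if F x = \<infinity> then \<infinity> else 0 :: ennreal)" for x
  have [measurable]: "G \<in> borel_measurable borel" unfolding G_def by measurable
  have "2 * G x = G x" for x by (simp add: G_def ennreal_mult_top)
  then have "bnorm G m 0 = 2 * bnorm G m 0"
    using bnorm_cmult[of G m 2 0] by simp
  moreover have "bnorm G m 0 < \<infinity>"
    using assms(2) by (intro le_less_trans[OF bnorm_mono[of G F]]) (auto simp: G_def)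
  ultimately have "bnorm G m 0 = 0"
    by (cases "bnorm G m 0") (auto simp: ennreal_mult[symmetric] ennreal_numeral[symmetric] simp del: ennreal_numeral)
  then have "AE x in lborel. G x = 0" by (rule bnorm_eq_0_imp[rotated]) simp
  then show ?thesis by (auto elim!: eventually_mono simp: G_def less_top split: if_splits)
qed

lemma L2_set_set_block:
  assumes "\<omega> \<in> unit_sphere J" "0 < \<rho>"
  shows "L2_set (\<lambda>j. set_block J \<rho> \<omega> x $ j) J = \<rho>"
proof -
  have "L2_set (\<lambda>j. set_block J \<rho> \<omega> x $ j) J = L2_set (\<lambda>j. \<rho> * \<omega> j) J"
    by (intro L2_set_cong) (auto simp: set_block_def)
  also have "\<dots> = \<rho> * L2_set \<omega> J" using assms by (simp add: L2_set_right_distrib)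
  finally show ?thesis using assms by (simp add: unit_sphere_def)
qed

lemma L2_set_set_block_other:
  assumes "J \<inter> K = {}"
  shows "L2_set (\<lambda>j. set_block J \<rho> \<omega> x $ j) K = L2_set (\<lambda>j. x $ j) K"
  using assms by (intro L2_set_cong) (auto simp: set_block_def)

text \<open>For a product of radial functions the norm factorises: a block contributes the radial
  norm of \<open>u i\<close> and the finite mass of its sphere to the power \<open>1 / q i\<close>.
  The induction keeps the factors of the blocks still to come.\<close>

lemma bnorm_product_finite:
  fixes u :: "nat \<Rightarrow> real \<Rightarrow> ennreal"
  assumes u[measurable]: "\<And>i. u i \<in> borel_measurable borel"
    and F: "\<And>x. F x \<le> (\<Prod>i\<in>{1..m}. u i (L2_set (\<lambda>j. x $ j) (block \<beta> i)))"
    and fin: "\<And>i. i \<in> {1..m} \<Longrightarrow> rad_norm k (block \<beta> i) (p i) (u i) < \<infinity>"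
  shows "bnorm F m 0 < \<infinity>"
proof -
  have "\<exists>C<\<infinity>. \<forall>x. bnorm F i x \<le> C * (\<Prod>l\<in>{i<..m}. u l (L2_set (\<lambda>j. x $ j) (block \<beta> l)))" if "i \<le> m" for i
    using that
  proof (induction i)
    case 0
    have "{0<..m} = {1..m}" by auto
    then show ?case using F by (intro exI[of _ 1]) auto
  next
    case (Suc i)
    have i: "Suc i \<in> {1..m}" using Suc by auto
    let ?J = "block \<beta> (Suc i)"
    let ?S = "enn_powr (emeasure (dunkl_sphere k ?J) (unit_sphere ?J)) (1 / q (Suc i))"
    obtain C where C: "C < \<infinity>" "\<And>x. bnorm F i x \<le> C * (\<Prod>l\<in>{i<..m}. u l (L2_set (\<lambda>j. x $ j) (block \<beta> l)))"
      using Suc by auto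
    let ?C = "C * ?S * rad_norm k ?J (p (Suc i)) (u (Suc i))"
    have "bnorm F (Suc i) x \<le> ?C * (\<Prod>l\<in>{Suc i<..m}. u l (L2_set (\<lambda>j. x $ j) (block \<beta> l)))" for x
    proof -
      let ?R = "\<Prod>l\<in>{Suc i<..m}. u l (L2_set (\<lambda>j. x $ j) (block \<beta> l))"
      have split: "{i<..m} = insert (Suc i) {Suc i<..m}" using i by auto
      have *: "bnorm F i (set_block ?J \<rho> \<omega> x) \<le> C * ?R * u (Suc i) \<rho>"
        if "\<omega> \<in> unit_sphere ?J" "0 < \<rho>" for \<rho> \<omega>
      proof -
        have "u l (L2_set (\<lambda>j. set_block ?J \<rho> \<omega> x $ j) (block \<beta> l)) = u l (L2_set (\<lambda>j. x $ j) (block \<beta> l))"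
          if "l \<in> {Suc i<..m}" for l
          using that by (subst L2_set_set_block_other) (auto simp: block_def)
        then show ?thesis
          using C(2)[of "set_block ?J \<rho> \<omega> x"] that by (simp add: split L2_set_set_block ac_simps)
      qed
      have "ang_norm k ?J (q (Suc i)) (\<lambda>\<omega>. bnorm F i (set_block ?J \<rho> \<omega> x)) \<le> C * ?R * ?S * u (Suc i) \<rho>"
        if "0 < \<rho>" for \<rho>
      proof -
        have "ang_norm k ?J (q (Suc i)) (\<lambda>\<omega>. bnorm F i (set_block ?J \<rho> \<omega> x))
            \<le> ang_norm k ?J (q (Suc i)) (\<lambda>\<omega>. C * ?R * u (Suc i) \<rho>)"
          using * that q_pos[OF i] by (intro ang_norm_mono) auto
        also have "\<dots> = C * ?R * u (Suc i) \<rho> * ?S"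
          using q_pos[OF i] by (simp add: ang_norm_def space_dunkl_sphere enn_powr_mult enn_powr_inverse_cancel)
        finally show ?thesis by (simp add: ac_simps)
      qed
      then have "bnorm F (Suc i) x \<le> rad_norm k ?J (p (Suc i)) (\<lambda>\<rho>. C * ?R * ?S * u (Suc i) \<rho>)"
        unfolding block_norm.simps by (intro rad_norm_mono p_pos[OF i])
      also have "\<dots> = C * ?R * ?S * rad_norm k ?J (p (Suc i)) (u (Suc i))"
        using p_pos[OF i] by (simp add: rad_norm_eq_Lp_norm Lp_norm_cmult rad_measure_def)
      finally show ?thesis by (simp add: ac_simps)
    qed
    moreover have "?C < \<infinity>"
      using C(1) fin[OF i] emeasure_dunkl_sphere_finite[of ?J k] k_nonneg by (simp add: ennreal_mult_less_top)
    ultimately show ?case by blast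
  qed
  from this[of m] obtain C where "C < \<infinity>" "bnorm F m 0 \<le> C" by auto
  then show ?thesis by (rule le_less_trans[rotated])
qed

end

subsection \<open>Central Morrey norms of non-negative functions\<close>

lemma AE_lborel_vec_nth_neq: "AE x in lborel. (x :: real ^ 'n::finite) $ j \<noteq> a"
  unfolding lborel_vec_eq_PiM
  by (subst AE_distr_iff) (auto intro!: AE_PiM_lborel_component_neq)

lemma sets_ball [measurable]: "ball (x :: 'a::metric_space) R \<in> sets borel"
  by simp

lemma measurable_dunkl_weight [measurable]:
  "(\<lambda>x :: real ^ 'n::finite. ennreal (\<Prod>j\<in>UNIV. \<bar>x $ j\<bar> powr (2 * k j))) \<in> borel_measurable borel"
  by measurable

lemma emeasure_dunkl_measure:
  assumes "A \<in> sets borel"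
  shows "emeasure (dunkl_measure k) A =
    (\<integral>\<^sup>+x. ennreal (\<Prod>j\<in>UNIV. \<bar>x $ j\<bar> powr (2 * k j)) * indicator A x \<partial>lborel)"
  unfolding dunkl_measure_def using assms by (subst emeasure_density) auto

text \<open>Both bounds guard the ball weight against degenerating: \<open>measure\<close> sends an
  infinite value to 0, and every power of 0 is 0.\<close>

lemma emeasure_dunkl_unit_ball:
  assumes "\<And>j. 0 \<le> k j"
  shows "emeasure (dunkl_measure k) (ball 0 1) < \<infinity>" "emeasure (dunkl_measure k) (ball 0 1) > 0"
proof -
  have "emeasure (dunkl_measure k) (ball 0 1) \<le> (\<integral>\<^sup>+x. indicator (ball 0 1) (x :: real ^ 'a) \<partial>lborel)"
    unfolding emeasure_dunkl_measure[OF borel_open[OF open_ball]]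
  proof (rule nn_integral_mono)
    fix x :: "real ^ 'a"
    show "ennreal (\<Prod>j\<in>UNIV. \<bar>x $ j\<bar> powr (2 * k j)) * indicator (ball 0 1) x \<le> indicator (ball 0 1) x"
    proof (cases "x \<in> ball 0 1")
      case True
      then have "\<bar>x $ j\<bar> \<le> 1" for j using component_le_norm_cart[of x j] by auto
      then have "(\<Prod>j\<in>UNIV. \<bar>x $ j\<bar> powr (2 * k j)) \<le> 1"
        using assms by (intro prod_le_1) (auto intro!: powr_le1)
      then show ?thesis using True by simp
    qed simp
  qed
  also have "\<dots> < \<infinity>" using emeasure_lborel_ball_finite[of "0 :: real ^ 'a" 1] by simp
  finally show "emeasure (dunkl_measure k) (ball 0 1) < \<infinity>" .
  show "emeasure (dunkl_measure k) (ball 0 1) > 0"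
  proof (rule ccontr)
    assume "\<not> ?thesis"
    then have "(\<integral>\<^sup>+x. ennreal (\<Prod>j\<in>UNIV. \<bar>x $ j\<bar> powr (2 * k j)) * indicator (ball 0 1) x \<partial>lborel) = 0"
      by (simp add: emeasure_dunkl_measure)
    then have "AE x in lborel. ennreal (\<Prod>j\<in>UNIV. \<bar>x $ j\<bar> powr (2 * k j)) * indicator (ball 0 1) x = 0"
      by (rule nn_integral_0_iff_AE[THEN iffD1, rotated])
         (intro borel_measurable_times_ennreal borel_measurable_indicator; simp add: measurable_dunkl_weight)
    moreover have "AE x in lborel. \<forall>j. (x :: real ^ 'a) $ j \<noteq> 0"
      by (subst AE_all_countable) (auto intro: AE_lborel_vec_nth_neq)
    ultimately have "AE x in lborel. x \<notin> ball (0 :: real ^ 'a) 1"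
    proof eventually_elim
      case (elim x)
      then have "0 < (\<Prod>j\<in>UNIV. \<bar>x $ j\<bar> powr (2 * k j))" by (intro prod_pos) auto
      with elim show ?case by (auto simp: indicator_def split: if_splits)
    qed
    then have "ball (0 :: real ^ 'a) 1 \<in> null_sets lborel" by (subst AE_iff_null_sets) auto
    then have "measure lborel (ball (0 :: real ^ 'a) 1) = 0" by (simp add: null_sets_def measure_def)
    then show False using content_ball_pos[of 1 "0 :: real ^ 'a"] by simp
  qed
qed

text \<open>The Jacobian gives the dimension and the weight gives twice the sum of the
  \<open>k j\<close>; together they form \<open>hom_dim k UNIV\<close>.\<close>

lemma emeasure_dunkl_ball:
  fixes k :: "'n::finite \<Rightarrow> real"
  assumes R: "0 < R"
  shows "emeasure (dunkl_measure k) (ball 0 R) =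
    ennreal (R powr hom_dim k UNIV) * emeasure (dunkl_measure k) (ball 0 1)"
proof -
  define w where "w x = ennreal (\<Prod>j\<in>UNIV. \<bar>x $ j\<bar> powr (2 * k j))" for x :: "real ^ 'n"
  have [measurable]: "w \<in> borel_measurable borel" unfolding w_def by measurable
  have w: "w (R *\<^sub>R x) * indicator (ball 0 R) (R *\<^sub>R x) =
      ennreal (R powr (2 * (\<Sum>j\<in>UNIV. k j))) * (w x * indicator (ball 0 1) x)" for x
  proof -
    have "(\<Prod>j\<in>UNIV. \<bar>(R *\<^sub>R x) $ j\<bar> powr (2 * k j)) =
        (\<Prod>j\<in>UNIV. R powr (2 * k j)) * (\<Prod>j\<in>UNIV. \<bar>x $ j\<bar> powr (2 * k j))"
      using R by (simp add: abs_mult powr_mult prod.distrib)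
    also have "(\<Prod>j\<in>UNIV. R powr (2 * k j)) = R powr (2 * (\<Sum>j\<in>UNIV. k j))"
      using R by (simp add: powr_sum[symmetric] sum_distrib_left)
    finally have "w (R *\<^sub>R x) = ennreal (R powr (2 * (\<Sum>j\<in>UNIV. k j))) * w x"
      by (simp add: w_def ennreal_mult prod_nonneg)
    moreover have "(indicator (ball 0 R) (R *\<^sub>R x) :: ennreal) = indicator (ball 0 1) x"
      using R by (simp add: indicator_def)
    ultimately show ?thesis by (simp add: mult.assoc)
  qed
  have "emeasure (dunkl_measure k) (ball 0 R) = (\<integral>\<^sup>+x. w x * indicator (ball 0 R) x \<partial>lborel)"
    by (simp add: emeasure_dunkl_measure w_def)
  also have "\<dots> = (\<integral>\<^sup>+x. w x * indicator (ball 0 R) x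
      \<partial>density (distr lborel borel (\<lambda>x. 0 + R *\<^sub>R x)) (\<lambda>_. \<bar>R\<bar> ^ DIM(real ^ 'n)))"
    using lborel_affine[of R "0 :: real ^ 'n"] R by simp
  also have "\<dots> = (\<integral>\<^sup>+x. ennreal (R ^ CARD('n)) * (w (R *\<^sub>R x) * indicator (ball 0 R) (R *\<^sub>R x)) \<partial>lborel)"
    using R by (subst nn_integral_density) (auto simp: nn_integral_distr)
  also have "\<dots> = ennreal (R ^ CARD('n)) * (ennreal (R powr (2 * (\<Sum>j\<in>UNIV. k j))) *
      (\<integral>\<^sup>+x. w x * indicator (ball 0 1) x \<partial>lborel))"
    unfolding w by (simp add: nn_integral_cmult)
  also have "\<dots> = ennreal (R powr hom_dim k UNIV) * (\<integral>\<^sup>+x. w x * indicator (ball 0 1) x \<partial>lborel)"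
    using R by (simp add: mult.assoc[symmetric] ennreal_mult[symmetric] hom_dim_def powr_add powr_realpow)
  also have "(\<integral>\<^sup>+x. w x * indicator (ball 0 1) x \<partial>lborel) = emeasure (dunkl_measure k) (ball 0 1)"
    by (simp add: emeasure_dunkl_measure w_def)
  finally show ?thesis .
qed

locale morrey_setting = mixed_norm_setting \<beta> m k p q
  for \<beta> :: "'n::finite \<Rightarrow> nat" and m k p q +
  fixes r :: real
  assumes r_pos: "0 < r"
    and exponents: "hom_dim k (UNIV :: 'n set) / r \<le> (\<Sum>i = 1..m. hom_dim k (block \<beta> i) / p i)"
begin

abbreviation "N \<equiv> hom_dim k (UNIV :: 'n set)"
abbreviation "S \<equiv> (\<Sum>i = 1..m. hom_dim k (block \<beta> i) / p i)"
definition "ball_weight R = measure (dunkl_measure k) (ball (0 :: real ^ 'n) R) powr (1 / r - 1 / N * S)"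
text \<open>Extends \<open>morrey_norm\<close> to \<open>ennreal\<close>-valued functions, as
  \<open>block_norm\<close> extends \<open>partial_norm\<close>.\<close>

definition "cnorm F = (SUP R\<in>{0<..}. ennreal (ball_weight R) * bnorm (\<lambda>x. F x * indicator (ball 0 R) x) m 0)"

lemma N_pos: "0 < N"
  using k_nonneg sum_nonneg[of UNIV k] by (simp add: hom_dim_def add_pos_nonneg)

lemma ball_weight_eq: "0 < R \<Longrightarrow> ball_weight R = R powr (N / r - S) * ball_weight 1"
proof -
  assume R: "0 < R"
  have "measure (dunkl_measure k) (ball (0 :: real ^ 'n) R) =
      R powr N * measure (dunkl_measure k) (ball (0 :: real ^ 'n) 1)"
    by (simp add: measure_def emeasure_dunkl_ball[OF R] enn2real_mult)
  moreover have "N * (1 / r - 1 / N * S) = N / r - S"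
    using N_pos by (simp add: right_diff_distrib)
  ultimately show ?thesis
    using R by (simp add: ball_weight_def powr_mult powr_powr)
qed

lemma ball_weight_1_pos: "0 < ball_weight 1"
proof -
  have "0 < measure (dunkl_measure k) (ball (0 :: real ^ 'n) 1)"
    unfolding measure_def enn2real_positive_iff
    using emeasure_dunkl_unit_ball[of k] k_nonneg by simp
  then show ?thesis by (simp add: ball_weight_def)
qed

lemma ball_weight_pos: "0 < R \<Longrightarrow> 0 < ball_weight R"
  using ball_weight_1_pos by (subst ball_weight_eq) auto

lemma morrey_norm_eq: "morrey_norm \<beta> m k r p q f = cnorm (\<lambda>x. ennreal (cmod (f x)))"
proof -
  have "ennreal (cmod (f x * indicator (ball 0 R) x)) = ennreal (cmod (f x)) * indicator (ball 0 R) x" for x R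
    by (simp add: indicator_def)
  then show ?thesis
    by (simp add: morrey_norm_def cnorm_def mixed_norm_def partial_norm_eq_block_norm ball_weight_def)
qed

lemma cnorm_upper: "0 < R \<Longrightarrow> ennreal (ball_weight R) * bnorm (\<lambda>x. F x * indicator (ball 0 R) x) m 0 \<le> cnorm F"
  unfolding cnorm_def by (intro SUP_upper) auto

lemma cnorm_mono_AE:
  assumes "AE x in lborel. F x \<le> G x"
  shows "cnorm F \<le> cnorm G"
  unfolding cnorm_def
proof (intro SUP_mono bexI)
  fix R :: real
  show "ennreal (ball_weight R) * bnorm (\<lambda>x. F x * indicator (ball 0 R) x) m 0
      \<le> ennreal (ball_weight R) * bnorm (\<lambda>x. G x * indicator (ball 0 R) x) m 0"
    using assms by (intro mult_left_mono bnorm_mono_AE) (auto elim!: eventually_mono intro: mult_right_mono)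
qed

lemma cnorm_cong_AE:
  assumes "AE x in lborel. F x = G x"
  shows "cnorm F = cnorm G"
  using assms by (intro antisym cnorm_mono_AE) (auto elim: eventually_mono)

lemma cnorm_cmult:
  assumes [measurable]: "F \<in> borel_measurable borel"
  shows "cnorm (\<lambda>x. c * F x) = c * cnorm F"
proof -
  have "ennreal (ball_weight R) * bnorm (\<lambda>x. c * F x * indicator (ball 0 R) x) m 0
      = c * (ennreal (ball_weight R) * bnorm (\<lambda>x. F x * indicator (ball 0 R) x) m 0)" for R
    using bnorm_cmult[of "\<lambda>x. F x * indicator (ball 0 R) x" m c 0] by (simp add: ac_simps)
  then show ?thesis by (simp add: cnorm_def SUP_mult_left_ennreal)
qed

text \<open>Truncating the dilated function at \<open>R\<close> is dilating the truncation at
  \<open>t * R\<close>. The mixed norm gives \<open>t powr (- S)\<close>, passing from the weight at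
  \<open>R\<close> to that at \<open>t * R\<close> costs \<open>t powr (N / r - S)\<close>, and the
  quotient is free of \<open>S\<close>. The supremum is unchanged under
  \<open>R \<mapsto> t * R\<close>.\<close>

lemma cnorm_dilation:
  assumes [measurable]: "F \<in> borel_measurable borel" and t: "0 < t"
  shows "cnorm (\<lambda>x. F (t *\<^sub>R x)) = ennreal (t powr (- (N / r))) * cnorm F"
proof -
  let ?h = "\<lambda>R. ennreal (ball_weight R) * bnorm (\<lambda>x. F x * indicator (ball 0 R) x) m 0"
  have "ennreal (ball_weight R) * bnorm (\<lambda>x. F (t *\<^sub>R x) * indicator (ball 0 R) x) m 0
      = ennreal (t powr (- (N / r))) * ?h (t * R)" if R: "0 < R" for R
  proof -
    have "(\<lambda>x. F (t *\<^sub>R x) * indicator (ball 0 R) x) =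
        (\<lambda>x. (\<lambda>y. F y * indicator (ball 0 (t * R)) y) (t *\<^sub>R x))"
      using t by (simp add: indicator_def fun_eq_iff)
    then have "bnorm (\<lambda>x. F (t *\<^sub>R x) * indicator (ball 0 R) x) m 0
        = ennreal (t powr (- S)) * bnorm (\<lambda>y. F y * indicator (ball 0 (t * R)) y) m 0"
      using bnorm_dilation[of "\<lambda>y. F y * indicator (ball 0 (t * R)) y" t m 0] t by simp
    moreover have "ball_weight R * t powr (- S) = t powr (- (N / r)) * ball_weight (t * R)"
    proof -
      have "t powr (- (N / r)) * t powr (N / r - S) = t powr (- S)"
        by (simp add: powr_add[symmetric])
      moreover have "t powr (- (N / r)) * ball_weight (t * R) = (t powr (- (N / r)) * t powr (N / r - S)) * ball_weight R"
        unfolding ball_weight_eq[OF R] ball_weight_eq[OF mult_pos_pos[OF t R]] by (simp add: powr_mult ac_simps)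
      ultimately show ?thesis by (simp only: mult.commute)
    qed
    ultimately show ?thesis
      using ball_weight_pos[OF R] ball_weight_pos[of "t * R"] t R
      by (simp add: mult.assoc[symmetric] ennreal_mult[symmetric] less_imp_le)
  qed
  then have "cnorm (\<lambda>x. F (t *\<^sub>R x)) = (SUP R\<in>{0<..}. ennreal (t powr (- (N / r))) * ?h (t * R))"
    unfolding cnorm_def by (intro SUP_cong) auto
  also have "\<dots> = ennreal (t powr (- (N / r))) * (SUP R\<in>{0<..}. ?h (t * R))"
    by (simp add: SUP_mult_left_ennreal)
  also have "(SUP R\<in>{0<..}. ?h (t * R)) = (SUP R\<in>(\<lambda>R. t * R) ` {0<..}. ?h R)"
    by (simp add: image_comp)
  also have "(\<lambda>R. t * R) ` {0<..} = {0<..}"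
  proof (intro equalityI subsetI)
    fix R :: real assume "R \<in> {0<..}"
    then show "R \<in> (\<lambda>R. t * R) ` {0<..}" using t by (intro image_eqI[of _ _ "R / t"]) auto
  qed (use t in auto)
  finally show ?thesis by (simp add: cnorm_def)
qed

text \<open>Minkowski on each ball; then the integrand for fixed \<open>R\<close> is bounded by its
  supremum.\<close>

lemma cnorm_nn_integral_le:
  assumes \<nu>: "sigma_finite_measure \<nu>"
    and G[measurable]: "(\<lambda>z. G (fst z) (snd z)) \<in> borel_measurable (\<nu> \<Otimes>\<^sub>M borel)"
  shows "cnorm (\<lambda>x. \<integral>\<^sup>+t. G t x \<partial>\<nu>) \<le> (\<integral>\<^sup>+t. cnorm (G t) \<partial>\<nu>)"
  unfolding cnorm_def[of "\<lambda>x. \<integral>\<^sup>+t. G t x \<partial>\<nu>"]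
proof (rule SUP_least)
  fix R :: real assume "R \<in> {0<..}"
  then have R: "0 < R" by simp
  have "bnorm (\<lambda>x. (\<integral>\<^sup>+t. G t x \<partial>\<nu>) * indicator (ball 0 R) x) m 0 \<le>
      bnorm (\<lambda>x. \<integral>\<^sup>+t. G t x * indicator (ball 0 R) x \<partial>\<nu>) m 0"
    by (intro bnorm_mono) (auto simp: indicator_def)
  also have "\<dots> \<le> (\<integral>\<^sup>+t. bnorm (\<lambda>x. G t x * indicator (ball 0 R) x) m 0 \<partial>\<nu>)"
    by (rule bnorm_nn_integral_le[OF \<nu>]) measurable
  finally have "ennreal (ball_weight R) * bnorm (\<lambda>x. (\<integral>\<^sup>+t. G t x \<partial>\<nu>) * indicator (ball 0 R) x) m 0 \<le>
      ennreal (ball_weight R) * (\<integral>\<^sup>+t. bnorm (\<lambda>x. G t x * indicator (ball 0 R) x) m 0 \<partial>\<nu>)"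
    by (intro mult_left_mono) auto
  also have "\<dots> = (\<integral>\<^sup>+t. ennreal (ball_weight R) * bnorm (\<lambda>x. G t x * indicator (ball 0 R) x) m 0 \<partial>\<nu>)"
    by (intro nn_integral_cmult[symmetric]
        measurable_bnorm_Pair1[where F="\<lambda>t x. G t x * indicator (ball 0 R) x" and f="\<lambda>t. t" and M=\<nu>]) measurable
  also have "\<dots> \<le> (\<integral>\<^sup>+t. cnorm (G t) \<partial>\<nu>)"
    by (intro nn_integral_mono cnorm_upper R)
  finally show "ennreal (ball_weight R) * bnorm (\<lambda>x. (\<integral>\<^sup>+t. G t x \<partial>\<nu>) * indicator (ball 0 R) x) m 0 \<le> (\<integral>\<^sup>+t. cnorm (G t) \<partial>\<nu>)" .
qed

lemma cnorm_finite_imp: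
  assumes [measurable]: "F \<in> borel_measurable borel" and fin: "cnorm F < \<infinity>"
  shows "AE x in lborel. F x < \<infinity>"
proof -
  have "AE x in lborel. F x * indicator (ball 0 (real (Suc n))) x < \<infinity>" for n
  proof (rule bnorm_finite_imp)
    have "ennreal (ball_weight (Suc n)) * bnorm (\<lambda>x. F x * indicator (ball 0 (Suc n)) x) m 0 < \<infinity>"
      using cnorm_upper[of "Suc n" F] fin by (auto intro: le_less_trans)
    then show "bnorm (\<lambda>x. F x * indicator (ball 0 (real (Suc n))) x) m 0 < \<infinity>"
      using ball_weight_pos[of "Suc n"] by (auto simp: ennreal_mult_less_top)
  qed measurable
  then have "AE x in lborel. \<forall>n. F x * indicator (ball 0 (real (Suc n))) x < \<infinity>"
    by (subst AE_all_countable) auto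
  then show ?thesis
  proof eventually_elim
    case (elim x)
    obtain n where "norm x < real n" using reals_Archimedean2 by blast
    then have "x \<in> ball 0 (real (Suc n))" by simp
    then show ?case using elim[rule_format, of n] by simp
  qed
qed

end

subsection \<open>The Hardy operator\<close>

lemma sigma_finite_lebesgue_on_unit: "sigma_finite_measure (lebesgue_on {0<..1::real})"
proof -
  have "{0<..1::real} \<in> lmeasurable"
    by (rule bounded_set_imp_lmeasurable) auto
  then have "finite_measure (lebesgue_on {0<..1::real})"
    by (rule finite_measure_lebesgue_on)
  then show ?thesis by (simp add: finite_measure_def)
qed

lemma AE_lebesgue_on_iff:
  fixes T :: "'a::euclidean_space set"
  assumes "T \<in> sets lebesgue"
  shows "(AE x in lebesgue_on T. P x) \<longleftrightarrow> (AE x in lborel. x \<in> T \<longrightarrow> P x)"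
  using assms by (subst AE_restrict_space_iff) (auto simp: AE_completion_iff)

text \<open>Completeness of Lebesgue measure, moved to a subset by extending with 0. It supplies
  measurability of \<open>f\<close> along rays, which does not follow from measurability of
  \<open>f\<close> alone.\<close>

lemma borel_measurable_AE_lebesgue_on:
  fixes f :: "'a::euclidean_space \<Rightarrow> 'b::euclidean_space"
  assumes T: "T \<in> sets lebesgue" and f: "f \<in> borel_measurable (lebesgue_on T)"
    and ae: "AE x in lebesgue_on T. f x = g x"
  shows "g \<in> borel_measurable (lebesgue_on T)"
proof -
  have "(\<lambda>x. if x \<in> T then f x else 0) \<in> borel_measurable lebesgue"
    using f T by (rule borel_measurable_if_I)
  moreover have "AE x in lebesgue. (if x \<in> T then f x else 0) = (if x \<in> T then g x else 0)"
    using ae T by (auto simp: AE_lebesgue_on_iff AE_completion_iff elim!: eventually_mono)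
  ultimately have "(\<lambda>x. if x \<in> T then g x else 0) \<in> borel_measurable lebesgue"
    by (rule borel_measurable_AE)
  then show ?thesis by (rule borel_measurable_if_D)
qed

lemma lebesgue_complex_AE_borel:
  fixes f :: "'a::euclidean_space \<Rightarrow> complex"
  assumes f: "f \<in> borel_measurable lebesgue"
  obtains g where "g \<in> borel_measurable borel" "AE x in lborel. f x = g x"
proof -
  have "(\<lambda>x. Re (f x)) \<in> borel_measurable lebesgue" "(\<lambda>x. Im (f x)) \<in> borel_measurable lebesgue"
    using f by measurable
  then obtain a b where a: "a \<in> borel_measurable lborel" "AE x in lborel. Re (f x) = a x"
    and b: "b \<in> borel_measurable lborel" "AE x in lborel. Im (f x) = b x"
    using completion_ex_borel_measurable_real by metis
  have "AE x in lborel. f x = Complex (a x) (b x)"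
    using a(2) b(2) by eventually_elim (simp add: complex_eq_iff)
  moreover have "(\<lambda>x. Complex (a x) (b x)) \<in> borel_measurable borel"
    using a(1) b(1) by (simp add: borel_measurable_complex_iff)
  ultimately show ?thesis using that by blast
qed

lemma AE_lborel_scaleR:
  fixes P :: "'a::euclidean_space \<Rightarrow> bool"
  assumes [measurable]: "Measurable.pred borel P" and c: "c \<noteq> 0" and P: "AE x in lborel. P x"
  shows "AE x in lborel. P (c *\<^sub>R x)"
  by (subst lborel_affine[of "1 / c" 0]) (use c P in \<open>auto simp: AE_density AE_distr_iff\<close>)

text \<open>Each dilation with \<open>t \<noteq> 0\<close> preserves null sets, and Tonelli
  exchanges \<open>t\<close> and \<open>x\<close>. Hence functions equal a.e. on the space are equal
  a.e. on almost every ray.\<close>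

lemma AE_on_rays:
  fixes P :: "'a::euclidean_space \<Rightarrow> bool"
  assumes P: "AE x in lborel. P x" 
  shows "AE x in lborel. AE t in lebesgue_on {0<..1::real}. P (t *\<^sub>R x)"
proof -
  obtain Q where Q: "Measurable.pred (lborel :: 'a measure) Q" "AE x in lborel. Q x"
      "\<And>x :: 'a. x \<in> space lborel \<Longrightarrow> Q x \<Longrightarrow> P x"
    using P by (rule AE_ex_measurable_pred) blast
  then have [measurable]: "Measurable.pred borel Q" by simp
  have "AE t in lborel. AE x in lborel. t \<in> {0<..1::real} \<longrightarrow> Q (t *\<^sub>R x)"
  proof (rule AE_I2)
    fix t :: real
    show "AE x in lborel. t \<in> {0<..1} \<longrightarrow> Q (t *\<^sub>R x)"
      using AE_lborel_scaleR[OF _ _ Q(2), of t] by (cases "t \<in> {0<..1}") auto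
  qed
  then have "AE x in lborel. AE t in lborel. t \<in> {0<..1::real} \<longrightarrow> Q (t *\<^sub>R x)"
    by (subst (asm) lborel_pair.AE_commute) measurable
  then show ?thesis
    using Q(3) by (auto simp: AE_lebesgue_on_iff elim!: eventually_mono)
qed

locale hardy_setting = morrey_setting \<beta> m k p q r
  for \<beta> :: "'n::finite \<Rightarrow> nat" and m k p q r +
  fixes \<phi> :: "real \<Rightarrow> real"
  assumes \<phi>_meas [measurable]: "\<phi> \<in> borel_measurable (lebesgue_on {0<..1})"
    and \<phi>_nonneg: "\<And>t. t \<in> {0<..1} \<Longrightarrow> 0 \<le> \<phi> t"
begin

abbreviation "\<nu> \<equiv> lebesgue_on {0<..1::real}"
definition "hardy_const = (\<integral>\<^sup>+t. ennreal (t powr (- (N / r)) * \<phi> t) \<partial>\<nu>)"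

lemma measurable_powr_\<nu> [measurable]: "(\<lambda>t. t powr a) \<in> borel_measurable \<nu>"
  by (intro measurable_restrict_space1 measurable_completion) measurable

lemma measurable_id_\<nu> [measurable]: "(\<lambda>t. t) \<in> borel_measurable \<nu>"
  by (intro measurable_restrict_space1 measurable_completion) measurable

lemma measurable_scaleR_\<nu> [measurable (raw)]:
  assumes "f \<in> M \<rightarrow>\<^sub>M \<nu>" and [measurable]: "g \<in> borel_measurable M"
  shows "(\<lambda>z. f z *\<^sub>R (g z :: real ^ 'n)) \<in> borel_measurable M"
proof -
  have [measurable]: "f \<in> borel_measurable M"
    using measurable_compose[OF assms(1) measurable_id_\<nu>] by simp
  show ?thesis by measurable
qed

text \<open>The Hardy operator applied to the modulus, always defined in \<open>ennreal\<close>; its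
  finiteness at a point is absolute convergence there.\<close>

definition abs_hardy :: "(real ^ 'n \<Rightarrow> complex) \<Rightarrow> real ^ 'n \<Rightarrow> ennreal" where
  "abs_hardy g x = (\<integral>\<^sup>+t. ennreal (\<phi> t) * ennreal (cmod (g (t *\<^sub>R x))) \<partial>\<nu>)"

lemma measurable_hardy_kernel:
  fixes g :: "real ^ 'n \<Rightarrow> complex"
  assumes [measurable]: "g \<in> borel_measurable borel"
  shows "(\<lambda>z. ennreal (\<phi> (fst z)) * ennreal (cmod (g (fst z *\<^sub>R snd z)))) \<in> borel_measurable (\<nu> \<Otimes>\<^sub>M borel)"
  by measurable

lemma cnorm_abs_hardy_le:
  assumes g[measurable]: "g \<in> borel_measurable borel"
  shows "cnorm (abs_hardy g) \<le> hardy_const * cnorm (\<lambda>x. ennreal (cmod (g x)))"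
proof -
  let ?M = "cnorm (\<lambda>x. ennreal (cmod (g x)))"
  have "cnorm (abs_hardy g) \<le> (\<integral>\<^sup>+t. cnorm (\<lambda>x. ennreal (\<phi> t) * ennreal (cmod (g (t *\<^sub>R x)))) \<partial>\<nu>)"
    unfolding abs_hardy_def[abs_def]
    by (rule cnorm_nn_integral_le[OF sigma_finite_lebesgue_on_unit measurable_hardy_kernel[OF g]])
  also have "\<dots> = (\<integral>\<^sup>+t. ennreal (t powr (- (N / r)) * \<phi> t) * ?M \<partial>\<nu>)"
  proof (rule nn_integral_cong)
    fix t assume "t \<in> space \<nu>"
    then have t: "t \<in> {0<..1}" by (simp add: space_restrict_space)
    have "cnorm (\<lambda>x. ennreal (\<phi> t) * ennreal (cmod (g (t *\<^sub>R x)))) =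
        ennreal (\<phi> t) * cnorm (\<lambda>x. ennreal (cmod (g (t *\<^sub>R x))))"
      by (rule cnorm_cmult) measurable
    also have "cnorm (\<lambda>x. ennreal (cmod (g (t *\<^sub>R x)))) = ennreal (t powr (- (N / r))) * ?M"
      using t by (intro cnorm_dilation[of "\<lambda>x. ennreal (cmod (g x))"]) auto
    finally show "cnorm (\<lambda>x. ennreal (\<phi> t) * ennreal (cmod (g (t *\<^sub>R x)))) =
        ennreal (t powr (- (N / r)) * \<phi> t) * ?M"
      using \<phi>_nonneg[OF t] by (simp add: ennreal_mult ac_simps)
  qed
  also have "\<dots> = hardy_const * ?M"
    unfolding hardy_const_def by (rule nn_integral_multc) measurable
  finally show ?thesis .
qed

text \<open>All norm estimates are made for a Borel representative \<open>g\<close> of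
  \<open>f\<close>. Finiteness of the norm of \<open>abs_hardy g\<close> gives absolute convergence
  almost everywhere, and \<open>AE_on_rays\<close> carries this over to \<open>f\<close>.\<close>

lemma hardy_estimate:
  assumes fin: "hardy_const < \<infinity>" and f: "f \<in> morrey_space \<beta> m k r p q"
  shows "AE x in lebesgue. hardy_defined_at \<phi> f x"
    and "hardy \<phi> f \<in> borel_measurable lebesgue"
    and "morrey_norm \<beta> m k r p q (hardy \<phi> f) \<le> hardy_const * morrey_norm \<beta> m k r p q f"
proof -
  interpret \<nu>: sigma_finite_measure \<nu> by (rule sigma_finite_lebesgue_on_unit)
  have f_meas: "f \<in> borel_measurable lebesgue" and f_fin: "morrey_norm \<beta> m k r p q f < \<infinity>"
    using f by (auto simp: morrey_space_def)
  obtain g where g[measurable]: "g \<in> borel_measurable borel" and fg: "AE x in lborel. f x = g x"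
    using lebesgue_complex_AE_borel[OF f_meas] by blast
  have norm_fg: "morrey_norm \<beta> m k r p q f = cnorm (\<lambda>x. ennreal (cmod (g x)))"
    unfolding morrey_norm_eq using fg by (intro cnorm_cong_AE) (auto elim!: eventually_mono)
  have "cnorm (abs_hardy g) < \<infinity>"
    using cnorm_abs_hardy_le[OF g] fin f_fin unfolding norm_fg
    by (auto simp: ennreal_mult_less_top intro: le_less_trans)
  moreover have "abs_hardy g \<in> borel_measurable borel"
  proof -
    have "(\<lambda>z. ennreal (\<phi> (snd z)) * ennreal (cmod (g (snd z *\<^sub>R fst z)))) \<in> borel_measurable (borel \<Otimes>\<^sub>M \<nu>)"
      by measurable
    then show ?thesis unfolding abs_hardy_def[abs_def] by measurable
  qed
  ultimately have max_fin: "AE x in lborel. abs_hardy g x < \<infinity>"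
    by (intro cnorm_finite_imp)
  \<comment> \<open>Borel as a parameter integral of a jointly measurable integrand; measurability
    of \<open>hardy \<phi> f\<close> is inherited from it through completeness.\<close>
  define G where "G x = (LINT t|\<nu>. g (t *\<^sub>R x) * complex_of_real (\<phi> t))" for x
  have G[measurable]: "G \<in> borel_measurable borel"
    unfolding G_def by measurable
  have *: "AE x in lborel. hardy_defined_at \<phi> f x \<and> hardy \<phi> f x = G x \<and> ennreal (cmod (hardy \<phi> f x)) \<le> abs_hardy g x"
    using max_fin AE_on_rays[OF fg]
  proof eventually_elim
    case (elim x)
    have gm: "(\<lambda>t. g (t *\<^sub>R x) * complex_of_real (\<phi> t)) \<in> borel_measurable \<nu>" by measurable
    have nn: "(\<integral>\<^sup>+t. ennreal (norm (g (t *\<^sub>R x) * complex_of_real (\<phi> t))) \<partial>\<nu>) = abs_hardy g x"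
      unfolding abs_hardy_def
      by (intro nn_integral_cong) (auto simp: norm_mult ennreal_mult \<phi>_nonneg space_restrict_space ac_simps)
    have gi: "integrable \<nu> (\<lambda>t. g (t *\<^sub>R x) * complex_of_real (\<phi> t))"
      using elim(1) nn gm by (intro integrableI_bounded) auto
    have ae: "AE t in \<nu>. g (t *\<^sub>R x) * complex_of_real (\<phi> t) = f (t *\<^sub>R x) * complex_of_real (\<phi> t)"
      using elim(2) by (auto elim!: eventually_mono)
    have fm: "(\<lambda>t. f (t *\<^sub>R x) * complex_of_real (\<phi> t)) \<in> borel_measurable \<nu>"
      by (rule borel_measurable_AE_lebesgue_on[OF _ gm ae]) simp
    have "hardy_defined_at \<phi> f x"
      unfolding hardy_defined_at_def using gi fm ae by (rule integrable_cong_AE_imp)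
    moreover have "hardy \<phi> f x = G x"
      unfolding hardy_def G_def using ae by (intro integral_cong_AE fm gm) (auto elim!: eventually_mono)
    moreover have "ennreal (cmod (G x)) \<le> abs_hardy g x"
      unfolding G_def nn[symmetric] by (rule integral_norm_bound_ennreal[OF gi])
    ultimately show ?case by simp
  qed
  show "AE x in lebesgue. hardy_defined_at \<phi> f x"
    using * by (auto simp: AE_completion_iff elim!: eventually_mono)
  show "hardy \<phi> f \<in> borel_measurable lebesgue"
  proof (rule borel_measurable_AE)
    show "G \<in> borel_measurable lebesgue" by (intro measurable_completion) simp
    show "AE x in lebesgue. G x = hardy \<phi> f x"
      unfolding AE_completion_iff using * by eventually_elim simp
  qed
  have "morrey_norm \<beta> m k r p q (hardy \<phi> f) \<le> cnorm (abs_hardy g)"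
    unfolding morrey_norm_eq using * by (intro cnorm_mono_AE) (auto elim!: eventually_mono)
  also have "\<dots> \<le> hardy_const * morrey_norm \<beta> m k r p q f"
    unfolding norm_fg by (rule cnorm_abs_hardy_le[OF g])
  finally show "morrey_norm \<beta> m k r p q (hardy \<phi> f) \<le> hardy_const * morrey_norm \<beta> m k r p q f" .
qed

lemma hardy_bound_hardy_const:
  assumes fin: "hardy_const < \<infinity>"
  shows "hardy_bound \<beta> m k r p q \<phi> (enn2real hardy_const)"
  unfolding hardy_bound_def
proof (intro conjI ballI)
  fix f assume f: "f \<in> morrey_space \<beta> m k r p q"
  have hardy_const: "ennreal (enn2real hardy_const) = hardy_const" using fin by simp
  note est = hardy_estimate[OF fin f]
  show "AE x in lebesgue. hardy_defined_at \<phi> f x" by (rule est)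
  show le: "morrey_norm \<beta> m k r p q (hardy \<phi> f) \<le> ennreal (enn2real hardy_const) * morrey_norm \<beta> m k r p q f"
    unfolding hardy_const by (rule est)
  have "hardy_const * morrey_norm \<beta> m k r p q f < \<infinity>"
    using f fin by (auto simp: morrey_space_def ennreal_mult_less_top)
  then show "hardy \<phi> f \<in> morrey_space \<beta> m k r p q"
    using est by (auto simp: morrey_space_def intro: le_less_trans)
qed simp

end

subsection \<open>Power functions cut off at the unit sphere\<close>

lemma nn_integral_powr_tail_finite:
  fixes c :: real
  assumes c: "0 < c"
  shows "(\<integral>\<^sup>+\<rho>. ennreal (\<rho> powr (- c - 1)) * indicator {1..} \<rho> \<partial>lborel) < \<infinity>"
proof -
  have "((\<lambda>\<rho>. - (\<rho> powr (- c)) / c) \<longlongrightarrow> - 0 / c) at_top"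
    using c by (intro tendsto_intros tendsto_neg_powr filterlim_ident) auto
  moreover have "DERIV (\<lambda>\<rho>. - (\<rho> powr (- c)) / c) \<rho> :> \<rho> powr (- c - 1)" if "1 \<le> \<rho>" for \<rho>
    using that c by (auto intro!: derivative_eq_intros)
  ultimately have "(\<integral>\<^sup>+\<rho>. ennreal (\<rho> powr (- c - 1)) * indicator {1..} \<rho> \<partial>lborel) =
      ennreal (- 0 / c - - (1 powr (- c)) / c)"
    by (intro nn_integral_FTC_atLeast) auto
  then show ?thesis by simp
qed

text \<open>Beyond 1 the integrand is \<open>\<rho> powr (- (\<eta> * s) - 1)\<close>, so any
  \<open>\<eta> > 0\<close> gives convergence. Below 1 it is at most 1, because the homogeneous
  dimension of a non-empty block is at least 1.\<close>

lemma rad_norm_power_tail_finite: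
  assumes J: "finite J" "J \<noteq> {}" and k: "\<And>j. 0 \<le> k j" and s: "0 < s" and \<eta>: "0 < \<eta>"
  shows "rad_norm k J s (\<lambda>\<rho>. ennreal (max 1 \<rho> powr (- (hom_dim k J / s + \<eta>)))) < \<infinity>"
proof -
  let ?N = "hom_dim k J"
  have "1 \<le> card J" using J by (simp add: Suc_leI card_gt_0_iff)
  then have N: "1 \<le> ?N"
    using sum_nonneg[of J k] k by (simp add: hom_dim_def add_increasing2)
  have le: "enn_powr (ennreal (max 1 \<rho> powr (- (?N / s + \<eta>)))) s * ennreal (\<rho> powr (?N - 1)) * indicator {0<..} \<rho>
      \<le> indicator {0..1} \<rho> + ennreal (\<rho> powr (- (\<eta> * s) - 1)) * indicator {1..} \<rho>" for \<rho>
  proof -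
    consider "\<rho> \<le> 0" | "0 < \<rho>" "\<rho> \<le> 1" | "1 < \<rho>" by linarith
    then show ?thesis
    proof cases
      case 2
      then have "\<rho> powr (?N - 1) \<le> 1" using N by (intro powr_le1) auto
      then have "ennreal (\<rho> powr (?N - 1)) \<le> 1" by simp
      with 2 show ?thesis by (simp add: max_def enn_powr_ennreal add_increasing2)
    next
      case 3
      have "(\<rho> powr (- (?N / s + \<eta>))) powr s * \<rho> powr (?N - 1) = \<rho> powr (- (\<eta> * s) - 1)"
      proof -
        have "- (?N / s + \<eta>) * s + (?N - 1) = - (\<eta> * s) - 1"
          using s by (simp add: algebra_simps)
        then show ?thesis by (simp only: powr_powr powr_add[symmetric])
      qed
      then show ?thesis using 3 by (simp add: enn_powr_ennreal ennreal_mult[symmetric])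
    qed simp
  qed
  have "(\<integral>\<^sup>+\<rho>\<in>{0<..}. (enn_powr (ennreal (max 1 \<rho> powr (- (?N / s + \<eta>)))) s * ennreal (\<rho> powr (?N - 1))) \<partial>lborel)
      \<le> (\<integral>\<^sup>+\<rho>. indicator {0..1::real} \<rho> + ennreal (\<rho> powr (- (\<eta> * s) - 1)) * indicator {1..} \<rho> \<partial>lborel)"
    by (intro nn_integral_mono le)
  also have "\<dots> = 1 + (\<integral>\<^sup>+\<rho>. ennreal (\<rho> powr (- (\<eta> * s) - 1)) * indicator {1..} \<rho> \<partial>lborel)"
    by (subst nn_integral_add) auto
  also have "\<dots> < \<infinity>"
    using nn_integral_powr_tail_finite[of "\<eta> * s"] \<eta> s by simp
  finally show ?thesis by (simp add: rad_norm_def)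
qed

text \<open>Without the cut-off, an exponent above \<open>N / r\<close> would give infinite norm:
  homogeneity and the scaling law together leave only the values 0 and infinity.\<close>

definition tail_power :: "real \<Rightarrow> 'a::real_normed_vector \<Rightarrow> real" where
  "tail_power a x = (if 1 < norm x then norm x powr (- a) else 0)"

lemma tail_power_nonneg: "0 \<le> tail_power a x"
  by (simp add: tail_power_def)

lemma measurable_tail_power [measurable]: "tail_power a \<in> borel_measurable borel"
  unfolding tail_power_def by measurable

lemma tail_power_scaleR:
  assumes "0 < t" "1 < norm (t *\<^sub>R x)" "1 < norm x"
  shows "tail_power a (t *\<^sub>R x) = t powr (- a) * tail_power a x"
  using assms by (simp add: tail_power_def powr_mult)

context morrey_setting
begin

lemma m_pos: "0 < m"
  using range_\<beta> by (cases m) auto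

lemma L2_set_block_le_norm: "L2_set (\<lambda>j. x $ j) J \<le> norm (x :: real ^ 'n)"
  unfolding norm_vec_def L2_set_def
  by (intro real_sqrt_le_mono) (simp add: sum_mono2)

text \<open>For |x| > 1, |x| dominates 1 and the norm of every block of \<open>x\<close>, so a
  negative power of |x| is at most a product of negative powers of the block norms, to which
  \<open>bnorm_product_finite\<close> applies.\<close>

lemma bnorm_tail_power_finite:
  assumes \<epsilon>: "0 < \<epsilon>"
  shows "bnorm (\<lambda>x. ennreal (tail_power (S + \<epsilon>) x)) m 0 < \<infinity>"
proof -
  \<comment> \<open>The surplus \<open>\<epsilon>\<close> is shared equally, which puts every block
    strictly above its own critical exponent.\<close>
  define a where "a i = hom_dim k (block \<beta> i) / p i + \<epsilon> / m" for i
  have a_nonneg: "0 \<le> a i" if "i \<in> {1..m}" for i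
    using that p_pos[OF that] \<epsilon> k_nonneg sum_nonneg[of "block \<beta> i" k]
    by (simp add: a_def hom_dim_def)
  have sum_a: "(\<Sum>i = 1..m. a i) = S + \<epsilon>"
    using m_pos by (simp add: a_def sum.distrib)
  show ?thesis
  proof (rule bnorm_product_finite[where u="\<lambda>i \<rho>. ennreal (max 1 \<rho> powr (- a i))"])
    fix x :: "real ^ 'n"
    show "ennreal (tail_power (S + \<epsilon>) x) \<le>
        (\<Prod>i\<in>{1..m}. ennreal (max 1 (L2_set (\<lambda>j. x $ j) (block \<beta> i)) powr (- a i)))"
    proof (cases "1 < norm x")
      case True
      have "tail_power (S + \<epsilon>) x = norm x powr (\<Sum>i = 1..m. - a i)"
        unfolding sum_negf sum_a tail_power_def using True by simp
      also have "\<dots> = (\<Prod>i\<in>{1..m}. norm x powr (- a i))"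
        by (rule powr_sum) (use True in auto)
      also have "\<dots> \<le> (\<Prod>i\<in>{1..m}. max 1 (L2_set (\<lambda>j. x $ j) (block \<beta> i)) powr (- a i))"
        using True a_nonneg L2_set_block_le_norm[of x]
        by (intro prod_mono conjI powr_mono2') auto
      finally show ?thesis by (simp add: prod_ennreal ennreal_leI)
    qed (simp add: tail_power_def)
  next
    fix i assume i: "i \<in> {1..m}"
    show "rad_norm k (block \<beta> i) (p i) (\<lambda>\<rho>. ennreal (max 1 \<rho> powr (- a i))) < \<infinity>"
      unfolding a_def using block_nonempty[OF i] k_nonneg p_pos[OF i] \<epsilon> m_pos
      by (intro rad_norm_power_tail_finite) auto
  qed measurable
qed

text \<open>On \<open>1 < \<bar>x\<bar> < R\<close> the factor \<open>R powr (N / r - S)\<close> is at most \<open>\<bar>x\<bar> powr (N / r - S)\<close>,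
  so one function of finite mixed norm dominates all truncations.\<close>

lemma cnorm_tail_power_finite:
  assumes \<epsilon>: "0 < \<epsilon>"
  shows "cnorm (\<lambda>x. ennreal (tail_power (N / r + \<epsilon>) x)) < \<infinity>"
proof -
  let ?K = "bnorm (\<lambda>x. ennreal (tail_power (S + \<epsilon>) x)) m 0"
  have "cnorm (\<lambda>x. ennreal (tail_power (N / r + \<epsilon>) x)) \<le> ennreal (ball_weight 1) * ?K"
    unfolding cnorm_def
  proof (rule SUP_least)
    fix R :: real assume "R \<in> {0<..}"
    then have R: "0 < R" by simp
    have "ennreal (R powr (N / r - S)) *
          bnorm (\<lambda>x. ennreal (tail_power (N / r + \<epsilon>) x) * indicator (ball 0 R) x) m 0 =
        bnorm (\<lambda>x. ennreal (R powr (N / r - S)) * (ennreal (tail_power (N / r + \<epsilon>) x) * indicator (ball 0 R) x)) m 0"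
      by (rule bnorm_cmult[symmetric]) auto
    also have "\<dots> \<le> ?K"
    proof (rule bnorm_mono)
      fix x :: "real ^ 'n"
      show "ennreal (R powr (N / r - S)) * (ennreal (tail_power (N / r + \<epsilon>) x) * indicator (ball 0 R) x)
          \<le> ennreal (tail_power (S + \<epsilon>) x)"
      proof (cases "1 < norm x \<and> norm x < R")
        case True
        have "R powr (N / r - S) * norm x powr (- (N / r + \<epsilon>)) \<le>
            norm x powr (N / r - S) * norm x powr (- (N / r + \<epsilon>))"
          using True exponents by (intro mult_right_mono powr_mono2') auto
        also have "\<dots> = norm x powr (- (S + \<epsilon>))"
          by (simp add: powr_add[symmetric])
        finally show ?thesis
          using True by (simp add: tail_power_def ennreal_mult[symmetric] ennreal_leI)
      qed (auto simp: tail_power_def)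
    qed
    finally have le: "ennreal (R powr (N / r - S)) *
        bnorm (\<lambda>x. ennreal (tail_power (N / r + \<epsilon>) x) * indicator (ball 0 R) x) m 0 \<le> ?K" .
    have "ennreal (ball_weight R) * bnorm (\<lambda>x. ennreal (tail_power (N / r + \<epsilon>) x) * indicator (ball 0 R) x) m 0 =
        ennreal (ball_weight 1) * (ennreal (R powr (N / r - S)) *
          bnorm (\<lambda>x. ennreal (tail_power (N / r + \<epsilon>) x) * indicator (ball 0 R) x) m 0)"
      using ball_weight_1_pos unfolding ball_weight_eq[OF R] by (simp add: ennreal_mult less_imp_le ac_simps)
    also have "\<dots> \<le> ennreal (ball_weight 1) * ?K"
      by (rule mult_left_mono[OF le]) simp
    finally show "ennreal (ball_weight R) * bnorm (\<lambda>x. ennreal (tail_power (N / r + \<epsilon>) x) * indicator (ball 0 R) x) m 0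
        \<le> ennreal (ball_weight 1) * ?K" .
  qed
  also have "\<dots> < \<infinity>"
    using bnorm_tail_power_finite[OF \<epsilon>] by (simp add: ennreal_mult_less_top)
  finally show ?thesis .
qed

text \<open>Needed to cancel the norm of the test function. Norm 0 would make the annulus 1 < |x| <
  2, where the function is positive, a null set.\<close>

lemma cnorm_tail_power_pos: "0 < cnorm (\<lambda>x. ennreal (tail_power a x))"
proof (rule ccontr)
  assume "\<not> ?thesis"
  then have "cnorm (\<lambda>x. ennreal (tail_power a x)) = 0" by simp
  then have "ennreal (ball_weight 2) * bnorm (\<lambda>x. ennreal (tail_power a x) * indicator (ball 0 2) x) m 0 = 0"
    using cnorm_upper[of 2 "\<lambda>x. ennreal (tail_power a x)"] by simp
  then have "bnorm (\<lambda>x. ennreal (tail_power a x) * indicator (ball 0 2) x) m 0 = 0"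
    using ball_weight_pos[of 2] by (simp add: ennreal_eq_0_iff not_le)
  then have "AE x in lborel. ennreal (tail_power a x) * indicator (ball (0 :: real ^ 'n) 2) x = 0"
    by (rule bnorm_eq_0_imp[rotated]) measurable
  \<comment> \<open>A closed set containing almost every point of an open set contains all of it;
    the closed unit ball then leads to a contradiction at a point of norm 3/2.\<close>
  then have "AE x in lborel. x \<in> {x. 1 < norm x \<and> norm x < 2} \<longrightarrow> x \<in> cball (0 :: real ^ 'n) 1"
    by eventually_elim (auto simp: tail_power_def indicator_def split: if_splits)
  then have ae: "AE x \<in> {x. 1 < norm x \<and> norm x < 2} in lebesgue. x \<in> cball (0 :: real ^ 'n) 1"
    by (rule AE_completion)
  obtain v :: "real ^ 'n" where v: "norm v = 3 / 2"
    using vector_choose_size[of "3 / 2"] by auto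
  have "open {x :: real ^ 'n. 1 < norm x \<and> norm x < 2}"
    by (intro open_Collect_conj open_Collect_less continuous_intros)
  moreover have "v \<in> {x. 1 < norm x \<and> norm x < 2}" by (simp add: v)
  ultimately have "v \<in> cball 0 1"
    using mem_closed_if_AE_lebesgue_open[OF _ closed_cball ae] by blast
  then show False by (simp add: v)
qed

end

section \<open>Sharpness of the constant\<close>

context hardy_setting
begin

text \<open>\<open>A\<close> is not known to be finite beforehand; its finiteness is part of the
  conclusion, as \<open>C\<close> is a real number.\<close>

lemma truncated_integral_le:
  assumes C: "hardy_bound \<beta> m k r p q \<phi> C" and \<delta>: "0 < \<delta>" "\<delta> < 1" and \<epsilon>: "0 < \<epsilon>"
  defines "A \<equiv> (\<integral>\<^sup>+t. ennreal (t powr (- (N / r)) * \<phi> t) * indicator {\<delta><..} t \<partial>\<nu>)"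
  shows "ennreal (\<delta> powr \<epsilon>) * A \<le> ennreal C"
proof -
  let ?a = "N / r + \<epsilon>"
  define F where "F x = ennreal (tail_power ?a x)" for x :: "real ^ 'n"
  define f where "f x = complex_of_real (tail_power ?a x)" for x :: "real ^ 'n"
  have F[measurable]: "F \<in> borel_measurable borel" unfolding F_def by measurable
  have fF: "morrey_norm \<beta> m k r p q f = cnorm F"
    by (simp add: morrey_norm_eq f_def F_def[abs_def] tail_power_nonneg)
  have "f \<in> borel_measurable borel" unfolding f_def by measurable
  then have "f \<in> borel_measurable lebesgue" by (intro measurable_completion) simp
  moreover have fin: "cnorm F < \<infinity>" unfolding F_def by (rule cnorm_tail_power_finite[OF \<epsilon>])
  ultimately have "f \<in> morrey_space \<beta> m k r p q" by (simp add: morrey_space_def fF)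
  then have def: "AE x in lborel. hardy_defined_at \<phi> f x"
    and bound: "morrey_norm \<beta> m k r p q (hardy \<phi> f) \<le> ennreal C * cnorm F"
    using C by (auto simp: hardy_bound_def AE_completion_iff fF)
  have "ennreal (\<delta> powr ?a) * A * cnorm (\<lambda>x. F (\<delta> *\<^sub>R x)) = cnorm (\<lambda>x. ennreal (\<delta> powr ?a) * A * F (\<delta> *\<^sub>R x))"
    by (rule cnorm_cmult[symmetric]) measurable
  also have "\<dots> \<le> morrey_norm \<beta> m k r p q (hardy \<phi> f)"
    unfolding morrey_norm_eq
  proof (rule cnorm_mono_AE)
    show "AE x in lborel. ennreal (\<delta> powr ?a) * A * F (\<delta> *\<^sub>R x) \<le> ennreal (cmod (hardy \<phi> f x))"
      using def
    proof eventually_elim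
      case (elim x)
      show ?case
      proof (cases "1 < norm (\<delta> *\<^sub>R x)")
        case False
        then show ?thesis by (simp add: F_def tail_power_def)
      next
        case True
        have x: "1 < norm x"
          using True \<delta> mult_right_mono[of \<delta> 1 "norm x"] by auto
        \<comment> \<open>Homogeneity is available here because both \<open>x\<close> and
          \<open>\<delta> *\<^sub>R x\<close> lie outside the cut-off. Where
          \<open>\<delta> *\<^sub>R x\<close> does not, the left side of the claim is 0.\<close>
        have Fx: "ennreal (\<delta> powr ?a) * F (\<delta> *\<^sub>R x) = F x"
          using tail_power_scaleR[OF \<delta>(1) True x, of ?a] \<delta>
          by (simp add: F_def ennreal_mult[symmetric] tail_power_nonneg mult.assoc[symmetric] powr_add[symmetric])
        let ?h = "\<lambda>t. tail_power ?a (t *\<^sub>R x) * \<phi> t"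
        have h_nonneg: "0 \<le> ?h t" if "t \<in> space \<nu>" for t
          using that by (simp add: tail_power_nonneg \<phi>_nonneg space_restrict_space)
        have int: "integrable \<nu> (\<lambda>t. complex_of_real (?h t))"
          using elim by (simp add: hardy_defined_at_def f_def)
        then have inth: "integrable \<nu> ?h" by (simp only: complex_of_real_integrable_eq)
        have "hardy \<phi> f x = complex_of_real (LINT t|\<nu>. ?h t)"
          unfolding hardy_def f_def of_real_mult[symmetric] by (rule integral_complex_of_real)
        then have "ennreal (cmod (hardy \<phi> f x)) = ennreal (LINT t|\<nu>. ?h t)"
          using Bochner_Integration.integral_nonneg[of \<nu> ?h] h_nonneg by simp
        also have "\<dots> = (\<integral>\<^sup>+t. ennreal (?h t) \<partial>\<nu>)"
          using inth h_nonneg by (intro nn_integral_eq_integral[symmetric]) auto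
        also have "\<dots> \<ge> (\<integral>\<^sup>+t. ennreal (t powr (- (N / r)) * \<phi> t) * indicator {\<delta><..} t * F x \<partial>\<nu>)"
        proof (rule nn_integral_mono)
          fix t assume "t \<in> space \<nu>"
          then have t: "t \<in> {0<..1}" by (simp add: space_restrict_space)
          show "ennreal (t powr (- (N / r)) * \<phi> t) * indicator {\<delta><..} t * F x \<le> ennreal (?h t)"
          proof (cases "\<delta> < t")
            case td: True
            have "norm (\<delta> *\<^sub>R x) \<le> norm (t *\<^sub>R x)"
              using td \<delta> by (simp add: mult_right_mono)
            then have "tail_power ?a (t *\<^sub>R x) = t powr (- ?a) * tail_power ?a x"
              using t True x by (intro tail_power_scaleR) auto
            \<comment> \<open>Since \<open>t \<le> 1\<close>, the additional
              \<open>\<epsilon>\<close> in the exponent only increases the power.\<close>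
            moreover have "t powr (- (N / r)) \<le> t powr (- ?a)"
              using t \<epsilon> by (intro powr_mono') auto
            then have "t powr (- (N / r)) * (\<phi> t * tail_power ?a x) \<le> t powr (- ?a) * (\<phi> t * tail_power ?a x)"
              using t by (intro mult_right_mono) (auto simp: \<phi>_nonneg tail_power_nonneg)
            ultimately show ?thesis
              using td t by (simp add: F_def ennreal_mult[symmetric] \<phi>_nonneg tail_power_nonneg ennreal_leI ac_simps)
          qed simp
        qed
        also have "(\<integral>\<^sup>+t. ennreal (t powr (- (N / r)) * \<phi> t) * indicator {\<delta><..} t * F x \<partial>\<nu>) = A * F x"
          unfolding A_def by (rule nn_integral_multc) measurable
        finally have "A * F x \<le> ennreal (cmod (hardy \<phi> f x))" .
        then show ?thesis by (simp add: Fx[symmetric] ac_simps)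
      qed
    qed
  qed
  also have "\<dots> \<le> ennreal C * cnorm F" by (rule bound)
  finally have "ennreal (\<delta> powr ?a) * A * (ennreal (\<delta> powr (- (N / r))) * cnorm F) \<le> ennreal C * cnorm F"
    by (simp add: cnorm_dilation \<delta>)
  moreover have "ennreal (\<delta> powr ?a) * A * (ennreal (\<delta> powr (- (N / r))) * cnorm F) =
      ennreal (\<delta> powr \<epsilon>) * A * cnorm F"
  proof -
    have "ennreal (\<delta> powr ?a) * ennreal (\<delta> powr (- (N / r))) = ennreal (\<delta> powr \<epsilon>)"
      by (simp add: ennreal_mult[symmetric] powr_add[symmetric])
    then show ?thesis by (simp add: ac_simps flip: mult.assoc)
  qed
  ultimately have "ennreal (\<delta> powr \<epsilon>) * A * cnorm F \<le> ennreal C * cnorm F" by simp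
  moreover have "0 < cnorm F" unfolding F_def by (rule cnorm_tail_power_pos)
  ultimately show ?thesis
    using fin by (simp add: mult.commute[of _ "cnorm F"] ennreal_mult_le_mult_iff less_top)
qed

lemma hardy_const_le:
  assumes C: "hardy_bound \<beta> m k r p q \<phi> C"
  shows "hardy_const \<le> ennreal C"
proof -
  define A where "A \<delta> = (\<integral>\<^sup>+t. ennreal (t powr (- (N / r)) * \<phi> t) * indicator {\<delta><..} t \<partial>\<nu>)" for \<delta>
  have C0: "0 \<le> C" using C by (simp add: hardy_bound_def)
  have A_le: "A \<delta> \<le> ennreal C" if \<delta>: "0 < \<delta>" "\<delta> < 1" for \<delta>
  proof -
    have *: "ennreal z * A \<delta> \<le> ennreal C" if z: "0 < z" "z < 1" for z
    proof -
      \<comment> \<open>Every \<open>z\<close> in (0,1) equals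
        \<open>\<delta> powr \<epsilon>\<close> for this positive value of \<epsilon>, so letting
        \<epsilon> tend to 0 becomes letting \<open>z\<close> tend to 1.\<close>
      have "0 < ln z / ln \<delta>" using z \<delta> by (simp add: divide_neg_neg)
      from truncated_integral_le[OF C \<delta> this] show ?thesis
        using z \<delta> by (simp add: A_def powr_def)
    qed
    \<comment> \<open>A single value of \<open>z\<close> yields finiteness, after which the limit
      can be taken in the reals.\<close>
    have "A \<delta> \<noteq> top" using *[of "1 / 2"] by (auto simp: ennreal_mult_top top_unique)
    then obtain a where a: "A \<delta> = ennreal a" "0 \<le> a" by (metis ennreal_cases)
    have "z * a \<le> C" if "0 < z" "z < 1" for z
      using *[OF that] a C0 that by (simp add: ennreal_mult[symmetric])
    then have "a \<le> C" by (rule field_le_mult_one_interval)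
    then show ?thesis by (simp add: a ennreal_leI)
  qed
  \<comment> \<open>The offset 2 keeps the cut-off strictly below 1, as \<open>A_le\<close> demands,
    already for \<open>n = 0\<close>.\<close>
  let ?g = "\<lambda>n t. ennreal (t powr (- (N / r)) * \<phi> t) * indicator {1 / real (n + 2)<..} t"
  have "hardy_const = (\<integral>\<^sup>+t. (SUP n. ?g n t) \<partial>\<nu>)"
    unfolding hardy_const_def
  proof (rule nn_integral_cong)
    fix t assume "t \<in> space \<nu>"
    then have t: "0 < t" by (simp add: space_restrict_space)
    then obtain n where "inverse (real (Suc n)) < t" using reals_Archimedean by blast
    moreover have "1 / real (n + 2) \<le> inverse (real (Suc n))" by (simp add: field_simps)
    ultimately have "1 / real (n + 2) < t" by linarith
    then have "ennreal (t powr (- (N / r)) * \<phi> t) = ?g n t" by simp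
    moreover have "?g n t \<le> (SUP n. ?g n t)" by (rule SUP_upper) simp
    moreover have "(SUP n. ?g n t) \<le> ennreal (t powr (- (N / r)) * \<phi> t)"
      by (rule SUP_least) (simp add: indicator_def)
    ultimately show "ennreal (t powr (- (N / r)) * \<phi> t) = (SUP n. ?g n t)" by simp
  qed
  also have "\<dots> = (SUP n. A (1 / real (n + 2)))"
    unfolding A_def
  proof (rule nn_integral_monotone_convergence_SUP)
    have "1 / real (n' + 2) \<le> 1 / real (n + 2)" if "n \<le> n'" for n n' :: nat
      using that by (intro divide_left_mono) auto
    then show "incseq ?g"
      by (auto simp: incseq_def le_fun_def indicator_def intro: le_less_trans)
    show "?g n \<in> borel_measurable \<nu>" for n by measurable
  qed
  also have "\<dots> \<le> ennreal C"
    by (intro SUP_least A_le) auto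
  finally show ?thesis .
qed

lemma hardy_bounded_iff: "hardy_bounded \<beta> m k r p q \<phi> \<longleftrightarrow> hardy_const < \<infinity>"
  using hardy_bound_hardy_const le_less_trans[OF hardy_const_le] unfolding hardy_bounded_def by (metis ennreal_less_top infinity_ennreal_def)

text \<open>\<open>LEAST\<close> ranges over reals and could be unspecified; here the minimum exists
  because the integral is itself an admissible bound and lies below all others.\<close>

lemma hardy_opnorm_eq: "hardy_opnorm \<beta> m k r p q \<phi> = hardy_const"
proof (cases "hardy_const < \<infinity>")
  case True
  have "(LEAST C. hardy_bound \<beta> m k r p q \<phi> C) = enn2real hardy_const"
  proof (rule Least_equality)
    fix C assume C: "hardy_bound \<beta> m k r p q \<phi> C"
    then have "0 \<le> C" by (simp add: hardy_bound_def)
    with hardy_const_le[OF C] show "enn2real hardy_const \<le> C" by (simp add: enn2real_leI)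
  qed (rule hardy_bound_hardy_const[OF True])
  then show ?thesis using True hardy_bounded_iff by (simp add: hardy_opnorm_def)
next
  case False
  then have "hardy_const = \<infinity>" by (simp add: not_less top_unique)
  with False show ?thesis by (simp add: hardy_opnorm_def hardy_bounded_iff)
qed

end

theorem theorem3p1:
  fixes \<beta> :: "'n::finite \<Rightarrow> nat" and m :: nat
    and k :: "'n \<Rightarrow> real" and r :: real and p q :: "nat \<Rightarrow> real"
    and \<phi> :: "real \<Rightarrow> real"
  assumes "CARD('n) \<ge> 2"
    and "range \<beta> = {1..m}"
    and "\<And>j. 0 \<le> k j"
    and "\<phi> \<in> borel_measurable (lebesgue_on {0<..1})"
    and "\<And>t. t \<in> {0<..1} \<Longrightarrow> 0 \<le> \<phi> t"
    and "0 < r"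
    and "\<And>i. i \<in> {1..m} \<Longrightarrow> 1 < p i"
    and "\<And>i. i \<in> {1..m} \<Longrightarrow> 1 < q i"
    and "(\<Sum>i = 1..m. hom_dim k (block \<beta> i) / p i) \<ge> hom_dim k (UNIV :: 'n set) / r"
  shows "(hardy_bounded \<beta> m k r p q \<phi> \<longleftrightarrow>
           (\<integral>\<^sup>+t. ennreal (t powr (- (hom_dim k (UNIV :: 'n set) / r)) * \<phi> t)
              \<partial>lebesgue_on {0<..1}) < \<infinity>)
       \<and> hardy_opnorm \<beta> m k r p q \<phi> =
           (\<integral>\<^sup>+t. ennreal (t powr (- (hom_dim k (UNIV :: 'n set) / r)) * \<phi> t)
              \<partial>lebesgue_on {0<..1})"
proof -
  interpret hardy_setting \<beta> m k p q r \<phi>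
    using assms by unfold_locales auto
  show ?thesis
    using hardy_bounded_iff hardy_opnorm_eq by (simp only: hardy_const_def)
qed

end
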